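(* Let $G$ be a $6$-regular graph on $n$ vertices. Then $G$ has a path partition with at most $\frac{n}{7}$ components; that is, $\pi_p(G)\le \frac{n}{7}$.
   Context: All graphs are finite, simple and undirected. A path partition of a graph $G=(V,E)$ is a set of vertex-disjoint paths of $G$ (a single vertex is allowed as a path) whose vertex sets together cover $V$; its members are called components. $\pi_p(G)$ denotes the minimum number of components of a path partition of $G$. *)

theory Defs
  imports Complex_Main
begin

definition simple_graph :: "'a set \<Rightarrow> ('a \<Rightarrow> 'a \<Rightarrow> bool) \<Rightarrow> bool" where
  "simple_graph V E \<longleftrightarrow> finite V \<and> (\<forall>x y. E x y \<longrightarrow> x \<in> V \<and> y \<in> V)
     \<and> (\<forall>x y. E x y \<longrightarrow> E y x) \<and> (\<forall>x. \<not> E x x)"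

definition degree :: "'a set \<Rightarrow> ('a \<Rightarrow> 'a \<Rightarrow> bool) \<Rightarrow> 'a \<Rightarrow> nat" where
  "degree V E v = card {u \<in> V. E v u}"

definition regular :: "'a set \<Rightarrow> ('a \<Rightarrow> 'a \<Rightarrow> bool) \<Rightarrow> nat \<Rightarrow> bool" where
  "regular V E k \<longleftrightarrow> (\<forall>v\<in>V. degree V E v = k)"

definition is_path :: "'a set \<Rightarrow> ('a \<Rightarrow> 'a \<Rightarrow> bool) \<Rightarrow> 'a list \<Rightarrow> bool" where
  "is_path V E p \<longleftrightarrow> p \<noteq> [] \<and> distinct p \<and> set p \<subseteq> V
     \<and> (\<forall>i. Suc i < length p \<longrightarrow> E (p ! i) (p ! Suc i))"

definition path_partition :: "'a set \<Rightarrow> ('a \<Rightarrow> 'a \<Rightarrow> bool) \<Rightarrow> 'a list set \<Rightarrow> bool" where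
  "path_partition V E P \<longleftrightarrow> (\<forall>p\<in>P. is_path V E p)
     \<and> (\<forall>p\<in>P. \<forall>q\<in>P. p \<noteq> q \<longrightarrow> set p \<inter> set q = {})
     \<and> (\<Union>p\<in>P. set p) = V"

definition path_partition_number :: "'a set \<Rightarrow> ('a \<Rightarrow> 'a \<Rightarrow> bool) \<Rightarrow> nat" where
  "path_partition_number V E = (LEAST k. \<exists>P. path_partition V E P \<and> finite P \<and> card P = k)"

end

(* Take a path partition that is minimal for the number of paths, then for the sum of 2^(-length)
   over the paths with an odd number of vertices, then for the number of paths that do not close up
   to a cycle.  A component "hits" an interior vertex of another path if one of its possible end
   vertices is adjacent to it; whenever a cover of the vertices of a few components by few paths
   exposes hit vertices as ends, these paths and the hitting components could be merged.

   Minimality forces odd components to hit only the even vertices of odd paths.  Exchanging pieces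
   along such hits, single vertices and open paths on three vertices generate a set I of possible
   ends whose neighbourhood is a smaller set R, which 6-regularity forbids.

   For the remaining components we discharge: every end receives 1/2 along each edge by which it
   hits (1/k on a cycle of length k), and we want each component to finish with at least 7 from
   the initial charge 1 per vertex.  Two consecutive vertices of a path can hardly
   both be hit, so this fails only for paths of odd length in which exactly the even vertices are hit and
   almost saturated.  There the third vertex could itself become an end after a rerouting, and it
   receives 1/4 along each edge leaving its path, which pays the deficit of at most 1. *)

theory Submission
  imports Defs "HOL-Library.Multiset"
begin

section \<open>Optimal path partitions\<close>

text \<open>The rates are tuned so that short components break even: an end of a two-vertex path has
  five edges leaving it, so the two ends collect 5 at rate 1/2; a vertex of a cycle on
  \<open>k\<close> vertices has at least \<open>7 - k\<close> such edges, so rate \<open>1/k\<close>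
  yields at least \<open>7 - k\<close> in total. An open path on \<open>m + 1\<close> vertices
  collects 5, less 1/2 for each chord at its ends, and can therefore afford to pay
  \<open>m - 1\<close>, chords included. A single vertex stops at 1 + 6/2 = 4, and an open path on
  three vertices may drop to 3 + 5 - 2 = 6; its third vertex is already an end and cannot pay the
  deficit. This is why these two cases are removed by a separate growth argument. The weight
  \<open>2^(-length)\<close> makes one odd path heavier than two odd paths that are longer by at
  least 2 each; parity then decides where a path can be cut. Paths that do not close up are counted
  last: crossing chords from the two ends would give a cycle, so they cannot occur, and the pieces
  of three vertices stay open during exchanges.\<close>

locale six_regular =
  fixes V :: "'a set" and E :: "'a \<Rightarrow> 'a \<Rightarrow> bool"
  assumes simple: "simple_graph V E" and reg: "regular V E 6"
begin

lemma finV: "finite V" and E_V: "E x y \<Longrightarrow> x \<in> V \<and> y \<in> V"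
  and E_sym: "E x y \<Longrightarrow> E y x" and E_irr: "\<not> E x x"
  using simple unfolding simple_graph_def by blast+

definition nbs :: "'a \<Rightarrow> 'a set" where "nbs v = {u \<in> V. E v u}"

lemma nbs_iff [simp]: "u \<in> nbs v \<longleftrightarrow> E v u"
  unfolding nbs_def using E_V by blast

lemma fin_nbs [simp]: "finite (nbs v)"
  unfolding nbs_def using finV by simp

lemma card_nbs: "v \<in> V \<Longrightarrow> card (nbs v) = 6"
  using reg unfolding regular_def degree_def nbs_def by blast

definition pth :: "'a list \<Rightarrow> bool" where
  "pth p \<longleftrightarrow> p \<noteq> [] \<and> successively E p"

lemma pth_Nil [simp]: "\<not> pth []"
  by (simp add: pth_def)

lemma pth_single [simp]: "pth [x]"
  by (simp add: pth_def)

lemma pth_append: "pth p \<Longrightarrow> pth q \<Longrightarrow> E (last p) (hd q) \<Longrightarrow> pth (p @ q)"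
  by (auto simp: pth_def successively_append_iff)

lemma pth_rev [simp]: "pth (rev p) \<longleftrightarrow> pth p"
proof -
  have "(\<lambda>x y. E y x) = E"
    using E_sym by blast
  then have "successively (\<lambda>x y. E y x) p = successively E p"
    by (rule arg_cong)
  then show ?thesis
    unfolding pth_def by simp
qed

lemma pth_appendD: "pth (p @ q) \<Longrightarrow> p \<noteq> [] \<Longrightarrow> pth p" "pth (p @ q) \<Longrightarrow> q \<noteq> [] \<Longrightarrow> pth q"
  by (auto simp: pth_def successively_append_iff)

lemma pth_take: "pth p \<Longrightarrow> 0 < k \<Longrightarrow> pth (take k p)"
  using pth_appendD(1)[of "take k p" "drop k p"] by (auto simp: pth_def)

lemma pth_drop: "pth p \<Longrightarrow> k < length p \<Longrightarrow> pth (drop k p)"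
  using pth_appendD(2)[of "take k p" "drop k p"] by (auto simp: pth_def)

lemma pth_nth: "pth p \<Longrightarrow> Suc i < length p \<Longrightarrow> E (p ! i) (p ! Suc i)"
  by (simp add: pth_def successively_conv_nth)

text \<open>One equation of multisets says that every vertex occurs exactly once. It contains
  covering, disjointness and distinctness, and an exchange of paths only has to compare multisets of
  vertices.\<close>

definition ppart :: "'a list multiset \<Rightarrow> bool" where
  "ppart P \<longleftrightarrow> (\<forall>p\<in>#P. pth p) \<and> \<Sum>\<^sub># (image_mset mset P) = mset_set V"

definition cyc :: "'a list \<Rightarrow> bool" where
  "cyc p \<longleftrightarrow> 3 \<le> length p \<and> E (last p) (hd p)"

text \<open>A path that closes up can be opened anywhere, so each of its vertices counts.
  \<open>cyc\<close> asks for three vertices because an edge traversed back and forth is no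
  cycle.\<close>

definition ends :: "'a list \<Rightarrow> 'a set" where
  "ends p = (if cyc p then set p else {hd p, last p})"

text \<open>The factor \<open>2 ^ card V\<close> only serves to keep \<open>2 ^ (- k)\<close> a natural number.\<close>

definition odd_weight :: "nat \<Rightarrow> nat" where
  "odd_weight k = (if odd k then 2 ^ (card V - k) else 0)"

definition odd_cost :: "'a list multiset \<Rightarrow> nat" where
  "odd_cost P = \<Sum>\<^sub># (image_mset (\<lambda>p. odd_weight (length p)) P)"

definition open_count :: "'a list multiset \<Rightarrow> nat" where
  "open_count P = size (filter_mset (\<lambda>p. 3 \<le> length p \<and> \<not> cyc p) P)"

definition better :: "'a list multiset \<Rightarrow> 'a list multiset \<Rightarrow> bool" where
  "better P Q \<longleftrightarrow> size P < size Q \<or> size P = size Q \<and> (odd_cost P < odd_cost Q \<or> odd_cost P = odd_cost Q \<and> open_count P < open_count Q)"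

definition opt :: "'a list multiset \<Rightarrow> bool" where
  "opt P \<longleftrightarrow> ppart P \<and> (\<forall>P'. ppart P' \<longrightarrow> \<not> better P' P)"

lemma odd_cost_simps [simp]: "odd_cost {#} = 0" "odd_cost (add_mset p P) = odd_weight (length p) + odd_cost P"
  "odd_cost (P + Q) = odd_cost P + odd_cost Q"
  by (simp_all add: odd_cost_def)

lemma open_count_simps [simp]: "open_count {#} = 0"
  "open_count (add_mset p P) = (if 3 \<le> length p \<and> \<not> cyc p then 1 else 0) + open_count P"
  "open_count (P + Q) = open_count P + open_count Q"
  by (simp_all add: open_count_def)

lemma ex_ppart: "ppart (image_mset (\<lambda>v. [v]) (mset_set V))"
proof -
  have "\<Sum>\<^sub># (image_mset mset (image_mset (\<lambda>v. [v]) M)) = M" for M :: "'a multiset"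
    by (induction M) auto
  then show ?thesis
    by (auto simp: ppart_def)
qed

lemma ex_opt: "\<exists>P. opt P"
proof -
  let ?r = "inv_image (less_than <*lex*> less_than <*lex*> less_than) (\<lambda>P. (size P, odd_cost P, open_count P))"
  have "wf ?r"
    by (intro wf_inv_image wf_lex_prod wf_less_than)
  then obtain P where "P \<in> Collect ppart" and "\<And>P'. (P', P) \<in> ?r \<Longrightarrow> P' \<notin> Collect ppart"
    by (rule wfE_min[of ?r _ "Collect ppart"]) (use ex_ppart in auto)
  then show ?thesis
    unfolding opt_def better_def by (intro exI[of _ P]) (auto simp: in_lex_prod)
qed

lemma optD: "opt P \<Longrightarrow> ppart P"
  by (simp add: opt_def)

lemma ppart_exchange:
  assumes "ppart P" "old \<subseteq># P" "\<And>q. q \<in># new \<Longrightarrow> pth q"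
    "\<Sum>\<^sub># (image_mset mset new) = \<Sum>\<^sub># (image_mset mset old)"
  shows "ppart (P - old + new)"
proof -
  obtain R where R: "P = old + R"
    using assms(2) subset_mset.le_iff_add by blast
  then show ?thesis
    using assms unfolding ppart_def by (auto simp: add.commute)
qed

text \<open>All three measures are additive over multiset union, so the untouched rest
  \<open>R\<close> cancels and a local comparison suffices.\<close>

lemma exchange:
  assumes "opt P" "old \<subseteq># P" "\<And>q. q \<in># new \<Longrightarrow> pth q"
    "\<Sum>\<^sub># (image_mset mset new) = \<Sum>\<^sub># (image_mset mset old)"
  shows "\<not> better new old"
proof -
  obtain R where R: "P = old + R"
    using assms(2) subset_mset.le_iff_add by blast
  have "ppart (R + new)"
    using ppart_exchange[OF optD[OF assms(1)] assms(2-4)] R by simp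
  then have "\<not> better (R + new) P"
    using assms(1) unfolding opt_def by blast
  then show ?thesis
    unfolding better_def R by simp
qed

text \<open>This moves between optimal partitions. A strict drop of \<open>open_count\<close> would
  contradict optimality, so its equality comes for free; it later forces split-off pieces to stay
  open.\<close>

lemma opt_exchange:
  assumes "opt P" "old \<subseteq># P" "\<And>q. q \<in># new \<Longrightarrow> pth q"
    "\<Sum>\<^sub># (image_mset mset new) = \<Sum>\<^sub># (image_mset mset old)"
    "size new = size old" "odd_cost new = odd_cost old" "open_count new \<le> open_count old"
  shows "opt (P - old + new)" and "open_count new = open_count old"
proof -
  have nb: "\<not> better new old"
    using exchange[OF assms(1-4)] .
  then show open_count: "open_count new = open_count old"
    using assms(5-7) by (auto simp: better_def)
  obtain R where R: "P = old + R"
    using assms(2) subset_mset.le_iff_add by blast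
  have "better P' (R + new) \<Longrightarrow> better P' P" for P'
    using assms(5-7) open_count unfolding better_def R by (simp add: add.commute)
  then show "opt (P - old + new)"
    using ppart_exchange[OF optD[OF assms(1)] assms(2-4)] assms(1) R unfolding opt_def by auto
qed

lemma sum_ppart:
  fixes g :: "'a \<Rightarrow> 'b::comm_monoid_add"
  assumes "ppart P"
  shows "\<Sum>\<^sub># (image_mset (\<lambda>p. sum_list (map g p)) P) = sum g V"
proof -
  have "\<Sum>\<^sub># (image_mset (\<lambda>p. sum_list (map g p)) M) = \<Sum>\<^sub># (image_mset g (\<Sum>\<^sub># (image_mset mset M)))" for M
    by (induction M) (auto simp flip: sum_mset_sum_list)
  then show ?thesis
    using assms by (simp add: ppart_def sum_unfold_sum_mset)
qed

lemma ppart_pth: "ppart P \<Longrightarrow> p \<in># P \<Longrightarrow> pth p"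
  by (simp add: ppart_def)

section \<open>Each vertex lies on exactly one path\<close>

lemma ppart_sub_le:
  assumes "ppart P" "S \<subseteq># P"
  shows "\<Sum>\<^sub># (image_mset mset S) \<subseteq># mset_set V"
proof -
  obtain R where "P = S + R"
    using assms(2) subset_mset.le_iff_add by blast
  then show ?thesis
    using assms(1) by (metis ppart_def image_mset_union sum_mset.union mset_subset_eq_add_left)
qed

lemma ppart_count_one:
  assumes "ppart P" "S \<subseteq># P"
  shows "count (\<Sum>\<^sub># (image_mset mset S)) v \<le> 1"
proof -
  have "count (\<Sum>\<^sub># (image_mset mset S)) v \<le> count (mset_set V) v"
    using ppart_sub_le[OF assms] by (rule mset_subset_eq_count)
  also have "\<dots> \<le> 1"
    using finV by (simp add: count_mset_set')
  finally show ?thesis .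
qed

lemma ppart_distinct:
  assumes "ppart P" "p \<in># P"
  shows "distinct p"
proof (rule ccontr)
  assume "\<not> distinct p"
  then obtain xs ys zs y where "p = xs @ [y] @ ys @ [y] @ zs"
    using not_distinct_decomp by blast
  then show False
    using ppart_count_one[OF assms(1), of "{#p#}" y] assms(2) by simp
qed

lemma ppart_subset: "ppart P \<Longrightarrow> p \<in># P \<Longrightarrow> set p \<subseteq> V"
  using ppart_sub_le[of P "{#p#}"] finV by (auto dest!: set_mset_mono)

lemma ppart_add_disjoint:
  assumes "ppart P" "{#p, q#} \<subseteq># P"
  shows "set p \<inter> set q = {}"
proof (rule ccontr)
  assume "set p \<inter> set q \<noteq> {}"
  then obtain v where "v \<in> set p" "v \<in> set q"
    by blast
  then have "1 \<le> count (mset p) v" "1 \<le> count (mset q) v"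
    by (simp_all add: Suc_le_eq)
  moreover have "count (mset p) v + count (mset q) v \<le> 1"
    using ppart_count_one[OF assms, of v] by simp
  ultimately show False
    by linarith
qed

lemma two_sub: "p \<in># P \<Longrightarrow> q \<in># P \<Longrightarrow> p \<noteq> q \<Longrightarrow> {#p, q#} \<subseteq># P"
  by (rule mset_subset_eqI) (auto simp: Suc_le_eq)

lemma ppart_disjoint: "ppart P \<Longrightarrow> p \<in># P \<Longrightarrow> q \<in># P \<Longrightarrow> p \<noteq> q \<Longrightarrow> set p \<inter> set q = {}"
  by (rule ppart_add_disjoint[OF _ two_sub])

lemma ppart_same: "ppart P \<Longrightarrow> p \<in># P \<Longrightarrow> q \<in># P \<Longrightarrow> v \<in> set p \<Longrightarrow> v \<in> set q \<Longrightarrow> p = q"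
  using ppart_disjoint by blast

lemma ppart_count:
  assumes "ppart P" "p \<in># P"
  shows "count P p = 1"
proof (rule ccontr)
  assume "count P p \<noteq> 1"
  with assms(2) have "2 \<le> count P p"
    by (metis One_nat_def Suc_1 Suc_leI count_greater_eq_one_iff le_neq_implies_less)
  then have "{#p, p#} \<subseteq># P"
    by (metis Suc_1 One_nat_def count_le_replicate_mset_subset_eq replicate_mset_0 replicate_mset_Suc)
  from ppart_add_disjoint[OF assms(1) this] ppart_pth[OF assms] show False
    by (cases p) auto
qed

lemma ppart_cover: 
  assumes "ppart P" "v \<in> V"
  obtains p where "p \<in># P" "v \<in> set p"
proof -
  have "v \<in># \<Sum>\<^sub># (image_mset mset P)"
    using assms finV by (simp add: ppart_def)
  then show ?thesis
    using that by auto
qed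

lemma subset_sub: "ppart P \<Longrightarrow> finite S \<Longrightarrow> S \<subseteq> set_mset P \<Longrightarrow> mset_set S \<subseteq># P"
  by (rule mset_subset_eqI) (auto simp: count_mset_set' Suc_le_eq)

lemma ppart_size:
  assumes "ppart P" "S \<subseteq># P"
  shows "\<Sum>\<^sub># (image_mset length S) \<le> card V"
proof -
  have "size (\<Sum>\<^sub># (image_mset mset M)) = \<Sum>\<^sub># (image_mset length M)" for M :: "'a list multiset"
    by (induction M) auto
  then show ?thesis
    using size_mset_mono[OF ppart_sub_le[OF assms]] by simp
qed

end

section \<open>Rerouting\<close>

context six_regular
begin

text \<open>The bound \<open>k' \<le> card V\<close> keeps the truncated difference
  \<open>card V - k'\<close> exact. The factor 4 lets one odd path outweigh two longer ones.\<close>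

lemma odd_weight_le: "odd k \<Longrightarrow> k + 2 \<le> k' \<Longrightarrow> k' \<le> card V \<Longrightarrow> 4 * odd_weight k' \<le> odd_weight k"
proof -
  assume *: "odd k" "k + 2 \<le> k'" "k' \<le> card V"
  have "4 * odd_weight k' \<le> 2 ^ (2 + (card V - k'))"
    by (simp add: odd_weight_def power_add)
  also have "\<dots> \<le> 2 ^ (card V - k)"
    using * by (intro power_increasing) auto
  finally show ?thesis
    using *(1) by (simp add: odd_weight_def)
qed

lemma odd_weight_pos: "odd k \<Longrightarrow> 0 < odd_weight k" and odd_weight_even [simp]: "even k \<Longrightarrow> odd_weight k = 0"
  by (simp_all add: odd_weight_def)

lemma odd_cost_le:
  assumes "opt P" "old \<subseteq># P" "\<And>q. q \<in># new \<Longrightarrow> pth q"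
    "\<Sum>\<^sub># (image_mset mset new) = \<Sum>\<^sub># (image_mset mset old)" "size new = size old"
  shows "odd_cost old \<le> odd_cost new"
  using exchange[OF assms(1-4)] assms(5) by (auto simp: better_def)

lemma ends_sub: "p \<noteq> [] \<Longrightarrow> ends p \<subseteq> set p"
  by (auto simp: ends_def)

lemma ends_start:
  assumes "pth p" "x \<in> ends p"
  obtains p' where "pth p'" "mset p' = mset p" "hd p' = x"
proof (cases "cyc p")
  case True
  then obtain a b where p: "p = a @ x # b"
    using assms by (auto simp: ends_def in_set_conv_decomp)
  show ?thesis
  proof (cases "a = []")
    case True
    then show ?thesis using that[of p] assms p by simp
  next
    case False
    have "pth (x # b)" "pth a"
      using assms(1) p pth_appendD[of a "x # b"] False by simp_all
    moreover have "E (last (x # b)) (hd a)"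
      using True p False by (auto simp: cyc_def)
    ultimately show ?thesis
      using that[of "(x # b) @ a"] pth_append[of "x # b" a] p by simp
  qed
next
  case False
  then have "x = hd p \<or> x = hd (rev p)"
    using assms by (auto simp: ends_def hd_rev)
  then show ?thesis
    using that[of p] that[of "rev p"] assms(1) by auto
qed

definition ham :: "'a list \<Rightarrow> 'a \<Rightarrow> 'a \<Rightarrow> bool" where
  "ham C x y \<longleftrightarrow> (\<exists>p. pth p \<and> mset p = mset C \<and> hd p = x \<and> last p = y)"

lemma sub_addI: "old \<subseteq># P \<Longrightarrow> C \<in># P - old \<Longrightarrow> add_mset C old \<subseteq># P"
proof -
  assume "old \<subseteq># P" "C \<in># P - old"
  moreover then obtain R where "P = old + R"
    using subset_mset.le_iff_add by blast
  ultimately show ?thesis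
    by simp
qed

lemma sub_addI2: "old \<subseteq># P \<Longrightarrow> C \<in># P - old \<Longrightarrow> D \<in># P - old \<Longrightarrow> C \<noteq> D \<Longrightarrow> add_mset C (add_mset D old) \<subseteq># P"
proof -
  assume "old \<subseteq># P" "C \<in># P - old" "D \<in># P - old" "C \<noteq> D"
  moreover then obtain R where "P = old + R"
    using subset_mset.le_iff_add by blast
  moreover from calculation have "{#C, D#} \<subseteq># R"
    by (intro two_sub) auto
  ultimately show ?thesis
    by (metis mset_subset_eq_mono_add_left_cancel union_mset_add_mset_right union_commute empty_neutral(2))
qed

lemma pth_end:
  assumes "pth q" "v \<in> {hd q, last q}"
  obtains q' where "pth q'" "mset q' = mset q" "last q' = v"
  using that[of q] that[of "rev q"] assms by (auto simp: last_rev)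

text \<open>Rerouting principle: a cover of the vertices of \<open>old\<close> by no more paths than \<open>old\<close> has,
  one of which ends in \<open>v\<close>, would absorb any further component with an end adjacent to \<open>v\<close>.\<close>

lemma no_attach:
  assumes "opt P" "old \<subseteq># P" "C \<in># P - old"
    and new: "\<forall>r\<in>#add_mset q new. pth r"
    "\<Sum>\<^sub># (image_mset mset (add_mset q new)) = \<Sum>\<^sub># (image_mset mset old)" "size new < size old"
    and "v \<in> {hd q, last q}" "x \<in> ends C" "E v x"
  shows False
proof -
  have C: "pth C"
    using assms(3) ppart_pth[OF optD[OF assms(1)]] by (auto dest: in_diffD)
  obtain c where c: "pth c" "mset c = mset C" "hd c = x"
    using ends_start[OF C assms(8)] by blast
  obtain q' where q': "pth q'" "mset q' = mset q" "last q' = v"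
    using pth_end[of q v] new(1) assms(7) by auto
  have "pth (q' @ c)"
    using c q' assms(9) pth_append by blast
  then have "\<not> better (add_mset (q' @ c) new) (add_mset C old)"
    using assms(1,3) new c q' sub_addI[OF assms(2,3)]
    by (intro exchange[OF assms(1)]) (auto simp: ac_simps)
  then show False
    using new(3) by (simp add: better_def)
qed

text \<open>Here the cover may use one path more than \<open>old\<close>. Absorbing two different
  components, or bridging \<open>q1\<close> and \<open>q2\<close> by a Hamiltonian path of a single
  one, still saves a path overall.\<close>

lemma attach_pair:
  assumes "opt P" "old \<subseteq># P" "C \<in># P - old" "D \<in># P - old"
    and new: "\<forall>r\<in>#add_mset q1 (add_mset q2 new). pth r"
    "\<Sum>\<^sub># (image_mset mset (add_mset q1 (add_mset q2 new))) = \<Sum>\<^sub># (image_mset mset old)" "size new < size old"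
    and "v \<in> {hd q1, last q1}" "w \<in> {hd q2, last q2}" "x \<in> ends C" "E v x" "y \<in> ends D" "E w y"
  shows "C = D" and "\<not> ham C x y"
proof -
  obtain r1 where r1: "pth r1" "mset r1 = mset q1" "last r1 = v"
    using pth_end[of q1 v] new(1) assms(8) by auto
  obtain r2 where r2: "pth r2" "mset r2 = mset q2" "last r2 = w"
    using pth_end[of q2 w] new(1) assms(9) by auto
  show "C = D"
  proof (rule ccontr)
    assume "C \<noteq> D"
    have C: "pth C" "pth D"
      using assms(3,4) ppart_pth[OF optD[OF assms(1)]] by (auto dest: in_diffD)
    obtain c where c: "pth c" "mset c = mset C" "hd c = x"
      using ends_start[OF C(1) assms(10)] by blast
    obtain d where d: "pth d" "mset d = mset D" "hd d = y"
      using ends_start[OF C(2) assms(12)] by blast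
    have "pth (r1 @ c)" "pth (r2 @ d)"
      using c d r1 r2 assms pth_append by blast+
    then have "\<not> better (add_mset (r1 @ c) (add_mset (r2 @ d) new)) (add_mset C (add_mset D old))"
      using new c d r1 r2 sub_addI2[OF assms(2-4) \<open>C \<noteq> D\<close>]
      by (intro exchange[OF assms(1)]) (auto simp: ac_simps)
    then show False
      using new(3) by (simp add: better_def)
  qed
  show "\<not> ham C x y"
  proof
    assume "ham C x y"
    then obtain c where c: "pth c" "mset c = mset C" "hd c = x" "last c = y"
      unfolding ham_def by blast
    then have "pth (r1 @ c)" "c \<noteq> []"
      using r1 assms(11) pth_append by auto
    moreover have "E (last (r1 @ c)) (hd (rev r2))"
      using c r2 assms(13) E_sym[of w y] \<open>c \<noteq> []\<close> by (simp add: hd_rev)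
    ultimately have "pth ((r1 @ c) @ rev r2)"
      using r2 pth_append[of "r1 @ c" "rev r2"] by simp
    then have "\<not> better (add_mset ((r1 @ c) @ rev r2) new) (add_mset C old)"
      using new c r1 r2 sub_addI[OF assms(2,3)]
      by (intro exchange[OF assms(1)]) (auto simp: ac_simps)
    then show False
      using new(3) by (simp add: better_def)
  qed
qed

lemma mset_take_drop: "mset (take k p) + mset (drop k p) = mset p"
  by (metis append_take_drop_id mset_append)

lemma last_take_Suc: "i < length p \<Longrightarrow> last (take (Suc i) p) = p ! i"
  by (simp add: take_Suc_conv_app_nth)

lemma hd_take: "0 < k \<Longrightarrow> hd (take k p) = hd p"
  by (cases p; cases k) auto

text \<open>Attaching \<open>C\<close> to the initial segment that ends in the hit vertex keeps the
  number of paths, so minimality speaks through \<open>odd_cost\<close>.\<close>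

lemma split_cover:
  assumes "opt P" "{#C, Q#} \<subseteq># P" "x \<in> ends C" "pth p" "mset p = mset Q" "Suc i < length p" "E x (p ! i)"
  shows "odd_weight (length C) + odd_weight (length Q) \<le> odd_weight (length C + Suc i) + odd_weight (length Q - Suc i)"
proof -
  have "C \<in># P"
    using assms(2) by (auto dest: mset_subset_eqD)
  then obtain c where c: "pth c" "mset c = mset C" "hd c = x"
    using ends_start[of C x] assms(3) ppart_pth[OF optD[OF assms(1)]] by blast
  have len: "length c = length C" "length p = length Q"
    using c assms mset_eq_length by blast+
  have "pth (rev c @ rev (take (Suc i) p))"
    using c assms pth_take[of p "Suc i"] last_take_Suc[of i p]
    by (intro pth_append) (auto simp: last_rev hd_rev)
  moreover have "pth (drop (Suc i) p)"
    using assms pth_drop by blast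
  ultimately have "odd_cost {#C, Q#} \<le> odd_cost {#rev c @ rev (take (Suc i) p), drop (Suc i) p#}"
    using c assms(5) mset_take_drop[of "Suc i" p]
    by (intro odd_cost_le[OF assms(1,2)]) (auto simp: ac_simps)
  then show ?thesis
    using len assms by (simp add: min_def)
qed

lemma ends_rev: "ends (rev p) = ends p"
  using E_sym by (auto simp: ends_def cyc_def hd_rev last_rev)

lemma cyc_rev: "cyc (rev p) = cyc p"
  using E_sym by (auto simp: cyc_def hd_rev last_rev)

lemma hit_interior:
  assumes "opt P" "{#C, Q#} \<subseteq># P" "x \<in> ends C" "E x v"
  shows "v \<notin> ends Q"
proof
  assume "v \<in> ends Q"
  have "Q \<in># P" "C \<in># P - {#Q#}"
    using assms(2) by (auto simp: subset_mset.le_iff_add)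
  obtain q where "pth q" "mset q = mset Q" "hd q = v"
    using ends_start[of Q v] \<open>v \<in> ends Q\<close> ppart_pth[OF optD[OF assms(1)] \<open>Q \<in># P\<close>] by blast
  with \<open>Q \<in># P\<close> \<open>C \<in># P - {#Q#}\<close> show False
    using no_attach[of P "{#Q#}" C q "{#}" v x] assms E_sym by auto
qed

text \<open>Splitting the path at a vertex violating the conclusion would decrease \<open>odd_cost\<close>.
  Indices count from 0, so \<open>odd i\<close> means an even vertex in the usual numbering.\<close>

lemma odd_hit:
  assumes "opt P" "{#C, Q#} \<subseteq># P" "x \<in> ends C" "odd (length C)" "i < length Q" "E x (Q ! i)"
  shows "odd i" "odd (length Q)" "\<not> cyc Q" "0 < i" "Suc i < length Q"
    "length Q \<le> length C + Suc i" "i \<le> length C"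
proof -
  have C: "C \<in># P" "Q \<in># P"
    using assms(2) by (auto dest: mset_subset_eqD)
  then have pQ: "pth Q"
    using assms optD ppart_pth by blast
  have int: "Q ! i \<notin> ends Q"
    using hit_interior[OF assms(1-3)] assms by blast
  then show nc: "\<not> cyc Q"
    using assms(5) by (auto simp: ends_def split: if_splits)
  then have "Q ! i \<noteq> hd Q" "Q ! i \<noteq> last Q"
    using int by (auto simp: ends_def)
  moreover have "hd Q = Q ! 0" "last Q = Q ! (length Q - 1)"
    using pQ by (auto simp: hd_conv_nth last_conv_nth pth_def)
  ultimately have "i \<noteq> 0" "i \<noteq> length Q - 1"
    by metis+
  then show i: "0 < i" "Suc i < length Q"
    using assms(5) by auto
  have cs: "length C + length Q \<le> card V"
    using ppart_size[OF optD[OF assms(1)] assms(2)] by simp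
  have 1: "odd_weight (length C) + odd_weight (length Q) \<le> odd_weight (length C + Suc i) + odd_weight (length Q - Suc i)"
    using split_cover[OF assms(1-3) pQ _ i(2) assms(6)] by simp
  \<comment> \<open>The same cut read from the other end of \<open>Q\<close>: now \<open>C\<close>
    takes the vertices from position \<open>i\<close> on, and \<open>i\<close> vertices
    remain.\<close>
  have 2: "odd_weight (length C) + odd_weight (length Q) \<le> odd_weight (length C + (length Q - i)) + odd_weight i"
    using split_cover[OF assms(1-3), of "rev Q" "length Q - Suc i"] pQ i assms(6)
    by (simp add: rev_nth Suc_diff_Suc)
  have p: "0 < odd_weight (length C)"
    using odd_weight_pos assms by blast
  have c1: "4 * odd_weight (length C + Suc i) \<le> odd_weight (length C)"
    using odd_weight_le[OF assms(4), of "length C + Suc i"] i cs by simp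
  have c2: "4 * odd_weight (length C + (length Q - i)) \<le> odd_weight (length C)"
    using odd_weight_le[OF assms(4), of "length C + (length Q - i)"] i cs by simp
  show oQ: "odd (length Q)"
  proof
    \<comment> \<open>Depending on the parity of \<open>i\<close>, one of the two cuts leaves an
      even remainder; the enlarged path alone weighs at most a quarter of \<open>C\<close>.\<close>
    assume e: "even (length Q)"
    then show False
      using 1 2 c1 c2 p i by (cases "even i") (auto simp: e)
  qed
  show oi: "odd i"
  proof
    assume "even i"
    then have "even (length Q - Suc i)" "even (length C + Suc i)"
      using oQ assms(4) i by auto
    then show False
      using 1 p by simp
  qed
  show "length Q \<le> length C + Suc i"
  proof (rule ccontr)
    assume "\<not> length Q \<le> length C + Suc i"
    then have "length C + 2 \<le> length Q - Suc i"
      using oi oQ assms(4) by presburger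
    then have "4 * odd_weight (length Q - Suc i) \<le> odd_weight (length C)"
      using odd_weight_le[OF assms(4), of "length Q - Suc i"] cs by simp
    then show False
      using 1 c1 p by simp
  qed
  show "i \<le> length C"
  proof (rule ccontr)
    assume "\<not> i \<le> length C"
    then have "length C + 2 \<le> i"
      using oi assms(4) by presburger
    then have "4 * odd_weight i \<le> odd_weight (length C)"
      using odd_weight_le[OF assms(4), of i] cs i by simp
    then show False
      using 2 c2 p by simp
  qed
qed

end

section \<open>Eliminating short odd paths\<close>

context six_regular
begin

text \<open>By \<open>odd_hit\<close>, an open piece of \<open>c\<close> vertices can hit \<open>p\<close> only where \<open>marked\<close> puts \<open>p\<close> into \<open>R\<close>.
  In \<open>growth\<close>, the set \<open>A\<close> has been explored, and every vertex of \<open>I\<close> is an end of such a piece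
  in an optimal partition that agrees with \<open>P0\<close> outside \<open>A\<close>.\<close>

definition marked :: "nat \<Rightarrow> 'a set \<Rightarrow> 'a list \<Rightarrow> bool" where
  "marked c R p \<longleftrightarrow> (\<forall>i. \<not> cyc p \<and> odd (length p) \<and> odd i \<and> i < length p \<and> length p \<le> c + Suc i \<and> i \<le> c \<longrightarrow> p ! i \<in> R)"

definition good :: "nat \<Rightarrow> 'a list multiset \<Rightarrow> 'a set \<Rightarrow> 'a set \<Rightarrow> 'a list multiset \<Rightarrow> 'a \<Rightarrow> bool" where
  "good c P0 A R P v \<longleftrightarrow> opt P \<and> (\<forall>p\<in>#P. \<not> set p \<subseteq> A \<longrightarrow> p \<in># P0 \<and> set p \<inter> A = {})
    \<and> (\<exists>q\<in>#P. set q \<subseteq> A \<and> length q = c \<and> \<not> cyc q \<and> v \<in> ends q) \<and> (\<forall>p\<in>#P. set p \<subseteq> A \<longrightarrow> marked c R p)"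

definition growth :: "nat \<Rightarrow> 'a list multiset \<Rightarrow> 'a set \<Rightarrow> 'a set \<Rightarrow> 'a set \<Rightarrow> bool" where
  "growth c P0 A I R \<longleftrightarrow> A \<subseteq> V \<and> I \<subseteq> A \<and> R \<subseteq> A \<and> card R < card I \<and> (\<forall>v\<in>I. \<exists>P. good c P0 A R P v)"

text \<open>Each vertex of \<open>I\<close> sends all its six edges into \<open>R\<close>, whose
  vertices can take only six each.\<close>

lemma double_count:
  assumes "I \<subseteq> V" "R \<subseteq> V" "\<And>v. v \<in> I \<Longrightarrow> nbs v \<subseteq> R"
  shows "card I \<le> card R"
proof -
  have fin: "finite I" "finite R"
    using assms finV finite_subset by blast+
  have "6 * card I = (\<Sum>v\<in>I. card {r \<in> R. E v r})"
  proof -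
    have "card {r \<in> R. E v r} = 6" if "v \<in> I" for v
    proof -
      have "{r \<in> R. E v r} = nbs v"
        using assms(3)[OF that] by auto
      then show ?thesis
        using card_nbs that assms(1) by auto
    qed
    then show ?thesis
      by simp
  qed
  also have "\<dots> = (\<Sum>v\<in>I. \<Sum>r\<in>R. if E v r then 1 else 0)"
    using fin by (simp add: sum.If_cases Int_def)
  also have "\<dots> = (\<Sum>r\<in>R. \<Sum>v\<in>I. if E v r then 1 else 0)"
    by (rule sum.swap)
  also have "\<dots> = (\<Sum>r\<in>R. card {v \<in> I. E v r})"
    using fin by (simp add: sum.If_cases Int_def)
  also have "\<dots> \<le> (\<Sum>r\<in>R. 6)"
  proof (rule sum_mono)
    fix r assume "r \<in> R"
    have "{v \<in> I. E v r} \<subseteq> nbs r"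
      using E_sym by auto
    then have "card {v \<in> I. E v r} \<le> card (nbs r)"
      by (intro card_mono) auto
    then show "card {v \<in> I. E v r} \<le> 6"
      using card_nbs assms(2) \<open>r \<in> R\<close> by auto
  qed
  finally show ?thesis
    by simp
qed

lemma marked_mono: "marked c R p \<Longrightarrow> R \<subseteq> R' \<Longrightarrow> marked c R' p"
  unfolding marked_def by blast

text \<open>Enlarging the explored set by a whole path of \<open>P0\<close> does no harm, because
  outside \<open>A\<close> the partition \<open>P\<close> still consists of paths of
  \<open>P0\<close>.\<close>

lemma good_mono:
  assumes "good c P0 A R P v" "ppart P0" "Q \<in># P0" "R \<subseteq> R'" "marked c R' Q"
  shows "good c P0 (A \<union> set Q) R' P v"
proof -
  have *: "opt P" "\<And>p. p \<in># P \<Longrightarrow> \<not> set p \<subseteq> A \<Longrightarrow> p \<in># P0 \<and> set p \<inter> A = {}"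
    "\<And>p. p \<in># P \<Longrightarrow> set p \<subseteq> A \<Longrightarrow> marked c R p"
    using assms(1) unfolding good_def by blast+
  have ne: "set p \<noteq> {}" if "p \<in># P" for p
    using ppart_pth[OF optD[OF *(1)] that] by auto
  have "p \<in># P0 \<and> set p \<inter> (A \<union> set Q) = {}" if "p \<in># P" "\<not> set p \<subseteq> A \<union> set Q" for p
    using *(2)[OF that(1)] that ppart_disjoint[OF assms(2) _ assms(3), of p] by auto
  moreover have "marked c R' p" if "p \<in># P" "set p \<subseteq> A \<union> set Q" for p
  proof (cases "set p \<subseteq> A")
    case True
    then show ?thesis
      using *(3) that marked_mono assms(4) by blast
  next
    case False
    then have "p \<in># P0" "set p \<inter> set Q \<noteq> {}"
      using *(2)[OF that(1)] that ne by auto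
    then have "p = Q"
      using ppart_disjoint[OF assms(2) _ assms(3)] by blast
    then show ?thesis
      using assms(5) by simp
  qed
  moreover have "\<exists>q\<in>#P. set q \<subseteq> A \<union> set Q \<and> length q = c \<and> \<not> cyc q \<and> v \<in> ends q"
    using assms(1) unfolding good_def by blast
  ultimately show ?thesis
    using *(1) unfolding good_def by blast
qed

text \<open>The piece \<open>q\<close> takes the initial segment of \<open>p\<close> up to the hit
  vertex, and the remaining \<open>c\<close> vertices form the new piece. The two lengths merely
  change places, so \<open>odd_cost\<close> is the same.\<close>

lemma good_swap:
  assumes "good c P0 A R P v" "ppart P0" "q \<in># P" "set q \<subseteq> A" "length q = c" "\<not> cyc q" "v \<in> ends q"
    and Q: "Q \<in># P" "Q \<in># P0" "set Q \<inter> A = {}" "\<not> cyc Q"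
    and p: "p = Q \<or> p = rev Q" "odd i" "Suc i + c = length p" "i \<le> c" "E v (p ! i)"
    and R: "R \<subseteq> R'" "\<And>k. odd k \<Longrightarrow> k < length p \<Longrightarrow> p ! k \<in> R'"
    and c: "c = 1 \<or> c = 3" and v': "v' = p ! Suc i \<or> v' = last p"
  shows "\<exists>P'. good c P0 (A \<union> set Q) R' P' v'"
proof -
  have opt: "opt P"
    and out: "\<And>p. p \<in># P \<Longrightarrow> \<not> set p \<subseteq> A \<Longrightarrow> p \<in># P0 \<and> set p \<inter> A = {}"
    and mk: "\<And>p. p \<in># P \<Longrightarrow> set p \<subseteq> A \<Longrightarrow> marked c R p"
    using assms(1) unfolding good_def by blast+
  note pp = optD[OF opt]
  have pq: "pth q" "pth Q"
    using ppart_pth[OF pp] assms(3) Q(1) by simp_all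
  have "q \<noteq> Q"
    using assms(4) Q(3) pq by (cases q) auto
  then have sub: "{#q, Q#} \<subseteq># P"
    by (rule two_sub[OF assms(3) Q(1)])
  have pp': "pth p" "mset p = mset Q" "set p = set Q" "length p = length Q"
    using p(1) pq by auto
  have "v \<in> {hd q, last q}"
    using assms(6,7) by (auto simp: ends_def)
  define r where "r = (if v = last q then q else rev q)"
  have r: "pth r" "mset r = mset q" "last r = v" "length r = c" "set r = set q" "r \<noteq> []"
    using \<open>v \<in> {hd q, last q}\<close> pq assms(5) unfolding r_def by (auto simp: last_rev)
  have rk: "r ! k \<in> R'" if "odd k" "k < c" for k
  proof -
    have "q ! j \<in> R" if "odd j" "j < c" for j
      using mk[OF assms(3,4)] that c assms(5,6) unfolding marked_def by auto
    moreover have "odd (c - Suc k)" "c - Suc k < c"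
      using that c by auto
    ultimately show ?thesis
      using that R(1) assms(5) unfolding r_def by (auto simp: rev_nth)
  qed
  define n1 where "n1 = r @ rev (take (Suc i) p)"
  define n2 where "n2 = drop (Suc i) p"
  have il: "Suc i < length p"
    using p c by auto
  have n1: "pth n1"
    unfolding n1_def using r pp' p il last_take_Suc[of i p] by (intro pth_append pth_rev[THEN iffD2] pth_take) (auto simp: hd_rev)
  have n2: "pth n2" "length n2 = c"
    unfolding n2_def using pth_drop pp' il p by auto
  have ln1: "length n1 = c + Suc i"
    using r il unfolding n1_def by simp
  have ms: "mset n1 + mset n2 = mset q + mset Q"
    unfolding n1_def n2_def using r pp' mset_take_drop[of "Suc i" p] by (simp add: ac_simps)
  have "set n1 \<union> set n2 = set q \<union> set Q"
    using ms by (metis set_mset_mset set_mset_union)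
  then have sets: "set n1 \<subseteq> A \<union> set Q" "set n2 \<subseteq> A \<union> set Q"
    using assms(4) by auto
  have len: "length Q = c + Suc i"
    using pp' p by simp
  have nuo: "open_count {#n1, n2#} \<le> open_count {#q, Q#}"
    using c assms(5,6) Q(4) n2(2) len odd_pos[OF p(2)] by auto
  have ex: "opt (P - {#q, Q#} + {#n1, n2#})" "open_count {#n1, n2#} = open_count {#q, Q#}"
  proof -
    have 1: "\<And>r. r \<in># {#n1, n2#} \<Longrightarrow> pth r"
      using n1 n2 by auto
    have 2: "\<Sum>\<^sub># (image_mset mset {#n1, n2#}) = \<Sum>\<^sub># (image_mset mset {#q, Q#})"
      "size {#n1, n2#} = size {#q, Q#}" "odd_cost {#n1, n2#} = odd_cost {#q, Q#}"
      using ms len ln1 n2 assms(5) by simp_all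
    show "opt (P - {#q, Q#} + {#n1, n2#})" "open_count {#n1, n2#} = open_count {#q, Q#}"
      using opt_exchange[OF opt sub 1 2 nuo] by blast+
  qed
  \<comment> \<open>For \<open>c = 3\<close> both old paths count as open, so equality of
    \<open>open_count\<close> leaves no room for \<open>n2\<close> to close up; for
    \<open>c = 1\<close> it is too short.\<close>
  have nc2: "\<not> cyc n2"
    using ex(2) c assms(5,6) Q(4) n2(2) len by (auto simp: cyc_def split: if_splits)
  have v'ends: "v' \<in> ends n2"
    using v' il nc2 unfolding ends_def n2_def by (auto simp: hd_drop_conv_nth)
  \<comment> \<open>\<open>marked\<close> looks only at positions up to \<open>c\<close>: in
    \<open>n1\<close> these lie in \<open>r\<close> or are the junction
    \<open>p ! i\<close>.\<close>
  have m1: "marked c R' n1"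
    unfolding marked_def
  proof (intro allI impI)
    fix k assume k: "\<not> cyc n1 \<and> odd (length n1) \<and> odd k \<and> k < length n1 \<and> length n1 \<le> c + Suc k \<and> k \<le> c"
    show "n1 ! k \<in> R'"
    proof (cases "k < c")
      case True
      then show ?thesis
        using rk k r unfolding n1_def by (simp add: nth_append)
    next
      case False
      then have "k = c"
        using k by auto
      then have "n1 ! k = p ! i"
        using r il unfolding n1_def by (simp add: nth_append rev_nth)
      then show ?thesis
        using R(2) p(2) il by simp
    qed
  qed
  have m2: "marked c R' n2"
    unfolding marked_def using R(2) p(2) n2 il unfolding n2_def by auto
  have in': "x \<in># P - {#q, Q#} + {#n1, n2#} \<Longrightarrow> x = n1 \<or> x = n2 \<or> x \<in># P \<and> x \<noteq> q \<and> x \<noteq> Q" for x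
  proof -
    assume x: "x \<in># P - {#q, Q#} + {#n1, n2#}"
    have "q \<notin># P - {#q, Q#}" "Q \<notin># P - {#q, Q#}"
      using ppart_count[OF pp assms(3)] ppart_count[OF pp Q(1)] \<open>q \<noteq> Q\<close>
      by (simp_all add: not_in_iff)
    then show ?thesis
      using x in_diffD[of x P "{#q, Q#}"] by auto
  qed
  have "p' \<in># P0 \<and> set p' \<inter> (A \<union> set Q) = {}"
    if "p' \<in># P - {#q, Q#} + {#n1, n2#}" "\<not> set p' \<subseteq> A \<union> set Q" for p'
  proof -
    have "p' \<in># P" "p' \<noteq> Q"
      using in'[OF that(1)] that(2) sets Q(1) by auto
    moreover have "\<not> set p' \<subseteq> A"
      using that(2) by blast
    ultimately show ?thesis
      using out[of p'] ppart_disjoint[OF pp _ Q(1), of p'] by blast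
  qed
  moreover have "marked c R' p'"
    if "p' \<in># P - {#q, Q#} + {#n1, n2#}" "set p' \<subseteq> A \<union> set Q" for p'
    using in'[OF that(1)]
  proof (elim disjE conjE)
    assume p': "p' \<in># P" "p' \<noteq> q" "p' \<noteq> Q"
    then have "set p' \<subseteq> A"
      using that ppart_disjoint[OF pp p'(1) Q(1)] by auto
    then show ?thesis
      using mk p' marked_mono R(1) by blast
  qed (use m1 m2 in auto)
  ultimately have "good c P0 (A \<union> set Q) R' (P - {#q, Q#} + {#n1, n2#}) v'"
    unfolding good_def using ex(1) sets(2) n2(2) nc2 v'ends by auto
  then show ?thesis
    by blast
qed

text \<open>A neighbour outside \<open>R\<close> lies on an unexplored path \<open>Q\<close>. The
  \<open>length Q div 2\<close> even vertices of \<open>Q\<close> join \<open>R\<close>, at least as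
  many other vertices of \<open>Q\<close> become possible ends, and so \<open>I\<close> stays larger
  than \<open>R\<close>.\<close>

lemma no_odd_piece_aux:
  assumes opt0: "opt P0" and c: "c = 1 \<or> c = 3" and growth: "growth c P0 A I R"
    and v: "v \<in> I" "E v u" "u \<notin> R"
  shows "\<exists>A' I' R'. growth c P0 A' I' R' \<and> card A < card A'"
proof -
  note pp0 = optD[OF opt0]
  have cf: "A \<subseteq> V" "I \<subseteq> A" "R \<subseteq> A" "card R < card I" "\<And>v. v \<in> I \<Longrightarrow> \<exists>P. good c P0 A R P v"
    using growth unfolding growth_def by blast+
  obtain P where P: "good c P0 A R P v"
    using cf(5) v by blast
  have opt: "opt P"
    and out: "\<And>p. p \<in># P \<Longrightarrow> \<not> set p \<subseteq> A \<Longrightarrow> p \<in># P0 \<and> set p \<inter> A = {}"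
    and mk: "\<And>p. p \<in># P \<Longrightarrow> set p \<subseteq> A \<Longrightarrow> marked c R p"
    using P unfolding good_def by blast+
  note pp = optD[OF opt]
  obtain q where q: "q \<in># P" "set q \<subseteq> A" "length q = c" "\<not> cyc q" "v \<in> ends q"
    using P unfolding good_def by blast
  obtain Q where Q: "Q \<in># P" "u \<in> set Q"
    using ppart_cover[OF pp, of u] E_V v by blast
  have "q \<noteq> Q"
  proof
    assume "q = Q"
    from c show False
    proof
      assume "c = 1"
      then obtain a where "q = [a]"
        using q(3) by (auto simp: length_Suc_conv)
      then show False
        using q v Q \<open>q = Q\<close> E_irr by (auto simp: ends_def split: if_splits)
    next
      assume "c = 3"
      then obtain a b d where abd: "q = [a, b, d]"
        using q(3) by (auto simp: numeral_3_eq_3 length_Suc_conv)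
      then have "q ! 1 \<in> R"
        using mk[OF q(1,2)] q \<open>c = 3\<close> unfolding marked_def by (elim allE[of _ 1]) auto
      then show False
        using abd q v Q \<open>q = Q\<close> E_irr E_sym by (auto simp: ends_def cyc_def)
    qed
  qed
  then have sub: "{#q, Q#} \<subseteq># P"
    by (rule two_sub[OF q(1) Q(1)])
  obtain i where i: "i < length Q" "u = Q ! i"
    using Q by (auto simp: in_set_conv_nth)
  have oc: "odd (length q)"
    using c q by auto
  have h: "odd i" "odd (length Q)" "\<not> cyc Q" "0 < i" "Suc i < length Q" "length Q \<le> c + Suc i" "i \<le> c"
    using odd_hit[OF opt sub q(5) oc i(1)] v i(2) q(3) by auto
  \<comment> \<open>Had \<open>Q\<close> been explored, \<open>marked\<close> would already place
    \<open>u\<close> in \<open>R\<close>.\<close>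
  have nA: "\<not> set Q \<subseteq> A"
    using mk[OF Q(1)] h v i unfolding marked_def by auto
  then have Q0: "Q \<in># P0" "set Q \<inter> A = {}"
    using out Q by blast+
  define RQ where "RQ = {Q ! k | k. odd k \<and> k < length Q}"
  define R' where "R' = R \<union> RQ"
  have RQs: "RQ \<subseteq> set Q"
    unfolding RQ_def by auto
  have dQ: "distinct Q"
    using ppart_distinct[OF pp Q(1)] .
  have mQ: "marked c R' Q"
    unfolding marked_def R'_def RQ_def by blast
  have cRQ: "card RQ = length Q div 2"
  proof -
    have "RQ = (\<lambda>k. Q ! (2 * k + 1)) ` {..<length Q div 2}"
    proof (intro equalityI subsetI)
      fix x assume "x \<in> RQ"
      then obtain k where "x = Q ! k" "odd k" "k < length Q"
        unfolding RQ_def by blast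
      then show "x \<in> (\<lambda>k. Q ! (2 * k + 1)) ` {..<length Q div 2}"
        using h(2) by (intro image_eqI[of _ _ "k div 2"]) (auto elim!: oddE)
    qed (auto simp: RQ_def)
    moreover have "inj_on (\<lambda>k. Q ! (2 * k + 1)) {..<length Q div 2}"
      using dQ by (intro inj_onI) (auto simp: nth_eq_iff_index_eq)
    ultimately show ?thesis
      by (simp add: card_image)
  qed
  have fin: "finite I" "finite R" "finite A" "finite RQ"
    using cf finV finite_subset RQs by (blast intro: finite_subset[of _ V] finite_subset[of _ "set Q"])+
  have extend: ?thesis if IQ: "IQ \<subseteq> set Q" "length Q div 2 \<le> card IQ" 
    "\<And>v. v \<in> IQ \<Longrightarrow> \<exists>P. good c P0 (A \<union> set Q) R' P v" for IQ
  proof -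
    have "finite IQ"
      using IQ finite_subset by blast
    then have "card (I \<union> IQ) = card I + card IQ" 
      using Q0 cf IQ fin by (intro card_Un_disjoint) auto
    moreover have "card R' = card R + card RQ"
      unfolding R'_def using Q0 cf RQs fin by (intro card_Un_disjoint) auto
    moreover have "\<exists>P. good c P0 (A \<union> set Q) R' P w" if "w \<in> I" for w
      using cf(5)[OF that] good_mono[OF _ pp0 Q0(1) _ mQ] unfolding R'_def by blast
    ultimately have "growth c P0 (A \<union> set Q) (I \<union> IQ) R'"
      unfolding growth_def using cf IQ cRQ RQs ppart_subset[OF pp Q(1)] unfolding R'_def by auto
    moreover have "card A < card (A \<union> set Q)"
      using nA fin by (intro psubset_card_mono) auto
    ultimately show ?thesis
      by blast
  qed
  have ROdd: "\<And>k. odd k \<Longrightarrow> k < length Q \<Longrightarrow> Q ! k \<in> R'"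
    unfolding R'_def RQ_def by blast
  have ROdd': "\<And>k. odd k \<Longrightarrow> k < length (rev Q) \<Longrightarrow> rev Q ! k \<in> R'"
    using h(2) by (auto simp: rev_nth intro!: ROdd)
  have right: "\<exists>P. good c P0 (A \<union> set Q) R' P v'" if "Suc i + c = length Q" "v' = Q ! Suc i \<or> v' = last Q" for v'
    using good_swap[OF P pp0 q Q(1) Q0 h(3), of Q i R' v'] h v i ROdd c that unfolding R'_def by auto
  have left: "\<exists>P. good c P0 (A \<union> set Q) R' P v'" if "i = c" "v' = Q ! (i - 1) \<or> v' = hd Q" for v'
  proof -
    have "rev Q ! (length Q - Suc i) = u" "rev Q ! Suc (length Q - Suc i) = Q ! (i - 1)"
      using h i by (auto simp: rev_nth Suc_diff_Suc)
    moreover have "odd (length Q - Suc i)" "length Q - Suc i \<le> c" "Suc (length Q - Suc i) + c = length (rev Q)"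
      using h i that by auto
    ultimately show ?thesis
      using good_swap[OF P pp0 q Q(1) Q0 h(3), of "rev Q" "length Q - Suc i" R' v'] v ROdd' c that
      unfolding R'_def by (auto simp: last_rev)
  qed
  have hdl: "hd Q = Q ! 0" "last Q = Q ! (length Q - 1)"
    using ppart_pth[OF pp Q(1)] by (auto simp: hd_conv_nth last_conv_nth pth_def)
  have nthQ: "Q ! a = Q ! b \<longleftrightarrow> a = b" if "a < length Q" "b < length Q" for a b
    using that dQ nth_eq_iff_index_eq by blast
  obtain a where a: "i = 2 * a + 1"
    using h(1) by (rule oddE)
  obtain b where b: "length Q = 2 * b + 1"
    using h(2) by (rule oddE)
  \<comment> \<open>Only lengths 3, 5 and 7 remain. Either \<open>Q\<close> is itself a piece with
    \<open>c\<close> vertices, or a cut just after or just before the hit vertex splits off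
    \<open>c\<close> vertices. Both cuts do so for \<open>c = 1\<close> and for length 7.\<close>
  have "length Q = c \<or> Suc i + c = length Q \<and> (i \<noteq> c \<or> c = 1) \<or> i = c \<and> Suc i + c \<noteq> length Q
    \<or> Suc i + c = length Q \<and> i = c \<and> c = 3"
    using c h(5-7) unfolding a b by (elim disjE) presburger+
  then consider "length Q = c" | "Suc i + c = length Q" "i \<noteq> c \<or> c = 1" | "i = c" "Suc i + c \<noteq> length Q"
    | "Suc i + c = length Q" "i = c" "c = 3"
    by blast
  then show ?thesis
  proof cases
    case 1
    then have "c = 3"
      using c h by auto
    have "Q ! 0 \<noteq> Q ! 2"
      using nthQ 1 \<open>c = 3\<close> by auto
    moreover have "good c P0 (A \<union> set Q) R' P w" if "w \<in> {hd Q, last Q}" for w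
    proof -
      have "good c P0 (A \<union> set Q) R' P v"
        using good_mono[OF P pp0 Q0(1) _ mQ] unfolding R'_def by blast
      moreover have "w \<in> ends Q"
        using that h(3) by (auto simp: ends_def)
      ultimately show ?thesis
        using Q(1) h(3) 1 unfolding good_def by blast
    qed
    ultimately show ?thesis
      using 1 \<open>c = 3\<close> hdl h by (intro extend[of "{hd Q, last Q}"]) auto
  next
    case 2
    show ?thesis
    proof (cases "c = 1")
      case True
      then have "i = 1" "length Q = 3"
        using h 2 by auto
      have "Q ! 2 \<noteq> Q ! 0"
        using nthQ \<open>length Q = 3\<close> by auto
      then have "length Q div 2 \<le> card {Q ! 2, Q ! 0}" "{Q ! 2, Q ! 0} \<subseteq> set Q"
        using \<open>length Q = 3\<close> by auto
      moreover have "\<exists>P. good c P0 (A \<union> set Q) R' P w" if "w \<in> {Q ! 2, Q ! 0}" for w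
        using that right[of w] left[of w] True \<open>i = 1\<close> \<open>length Q = 3\<close> by (auto simp: numeral_2_eq_2)
      ultimately show ?thesis
        by (intro extend)
    next
      case False
      then have *: "c = 3" "Suc i = 2" "length Q = 5"
        using c h(5-7) 2 unfolding a b by auto
      have "\<exists>P. good c P0 (A \<union> set Q) R' P (Q ! Suc i)" "\<exists>P. good c P0 (A \<union> set Q) R' P (last Q)"
        using right 2 by blast+
      then have "\<exists>P. good c P0 (A \<union> set Q) R' P (Q ! 2)" "\<exists>P. good c P0 (A \<union> set Q) R' P (Q ! 4)"
        using * hdl(2) by simp_all
      moreover have "Q ! 2 \<noteq> Q ! 4"
        using nthQ \<open>length Q = 5\<close> by auto
      ultimately show ?thesis
        using *(3) by (intro extend[of "{Q ! 2, Q ! 4}"]) auto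
    qed
  next
    case 3
    then have *: "c = 3" "i - 1 = 2" "length Q = 5"
      using c h(5-7) unfolding a b by auto
    have "\<exists>P. good c P0 (A \<union> set Q) R' P (Q ! (i - 1))" "\<exists>P. good c P0 (A \<union> set Q) R' P (hd Q)"
      using left 3 by blast+
    then have "\<exists>P. good c P0 (A \<union> set Q) R' P (Q ! 2)" "\<exists>P. good c P0 (A \<union> set Q) R' P (Q ! 0)"
      using * hdl(1) by simp_all
    moreover have "Q ! 2 \<noteq> Q ! 0"
      using nthQ \<open>length Q = 5\<close> by auto
    ultimately show ?thesis
      using *(3) by (intro extend[of "{Q ! 2, Q ! 0}"]) auto
  next
    case 4
    then have "length Q = 7"
      by simp
    then have "card {Q ! 0, Q ! 2, Q ! 4, Q ! 6} = 4"
      using nthQ by auto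
    moreover have "\<exists>P. good c P0 (A \<union> set Q) R' P (Q ! (i - 1))" "\<exists>P. good c P0 (A \<union> set Q) R' P (hd Q)"
      "\<exists>P. good c P0 (A \<union> set Q) R' P (Q ! Suc i)" "\<exists>P. good c P0 (A \<union> set Q) R' P (last Q)"
      using left right 4 by blast+
    moreover have "i - 1 = 2" "Suc i = 4" "length Q - 1 = 6"
      using 4 \<open>length Q = 7\<close> by simp_all
    ultimately show ?thesis
      using hdl \<open>length Q = 7\<close> by (intro extend[of "{Q ! 0, Q ! 2, Q ! 4, Q ! 6}"]) auto
  qed
qed

text \<open>Exchanging the piece with the odd paths that it hits grows a set \<open>I\<close> of possible ends
  whose neighbourhood is \<open>R\<close> and which is larger than \<open>R\<close>, contradicting regularity.\<close>

lemma no_odd_piece: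
  assumes opt: "opt P" and q: "q \<in># P" "length q = c" "\<not> cyc q" and c: "c = 1 \<or> c = 3"
  shows False
proof -
  note pp = optD[OF opt]
  define R0 where "R0 = {q ! k | k. odd k \<and> k < length q}"
  have dq: "distinct q"
    using ppart_distinct[OF pp q(1)] .
  have "good c P (set q) R0 P v" if "v \<in> ends q" for v
  proof -
    have "marked c R0 p" if "p \<in># P" "set p \<subseteq> set q" for p
    proof -
      have "p = q"
        using ppart_disjoint[OF pp that(1) q(1)] that ppart_pth[OF pp that(1)] by (cases p) auto
      then show ?thesis
        unfolding marked_def R0_def by blast
    qed
    moreover have "set p \<inter> set q = {}" if "p \<in># P" "\<not> set p \<subseteq> set q" for p
      using ppart_disjoint[OF pp that(1) q(1)] that by auto
    ultimately show ?thesis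
      unfolding good_def using opt q that by blast
  qed
  moreover have "card R0 < card (ends q)"
  proof (cases "c = 1")
    case True
    then have "R0 = {}" "length q = 1"
      using q unfolding R0_def by auto
    then show ?thesis
      using q(3) by (simp add: ends_def card_gt_0_iff)
  next
    case False
    then obtain a b d where abd: "q = [a, b, d]"
      using q(2) c by (auto simp: numeral_3_eq_3 length_Suc_conv)
    have "k = 1" if "odd k" "k < 3" for k :: nat
      using that by presburger
    then have "R0 \<subseteq> {q ! 1}"
      unfolding R0_def using abd by force
    then have "R0 \<subseteq> {b}"
      using abd by simp
    then have "card R0 \<le> 1"
      using card_mono[of "{b}" R0] by simp
    then show ?thesis
      using q(3) abd dq by (auto simp: ends_def)
  qed
  moreover have "ends q \<subseteq> set q" "R0 \<subseteq> set q"
    using ends_sub ppart_pth[OF pp q(1)] unfolding R0_def by (auto simp: pth_def)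
  ultimately have c0: "growth c P (set q) (ends q) R0"
    unfolding growth_def using ppart_subset[OF pp q(1)] by blast
  have "\<exists>A I R. growth c P A I R \<and> n \<le> card A" for n
  proof (induction n)
    case 0
    then show ?case using c0 by blast
  next
    case (Suc n)
    then obtain A I R where A: "growth c P A I R" "n \<le> card A"
      by blast
    then have "\<not> card I \<le> card R" "I \<subseteq> V" "R \<subseteq> V"
      unfolding growth_def by auto
    then obtain v u where "v \<in> I" "E v u" "u \<notin> R"
      using double_count by (metis nbs_iff subsetI)
    from no_odd_piece_aux[OF opt c A(1) this] A(2) show ?case
      by (meson Suc_leI le_less_trans)
  qed
  then obtain A I R where "growth c P A I R" "Suc (card V) \<le> card A"
    by blast
  then show False
    unfolding growth_def using card_mono[OF finV, of A] by auto
qed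

end

section \<open>Loads on vertices and slots of a path\<close>

text \<open>Slot \<open>j\<close> lies between the positions \<open>j\<close> and \<open>Suc j\<close> of a path; \<open>S j = 1\<close> if it holds a chord,
  which means that the first vertex is adjacent to position \<open>Suc j\<close> or the last one to position \<open>j\<close>.
  The load \<open>F i\<close> is what position \<open>i\<close> has to pay, and \<open>y\<close> distributes the total over the slots.\<close>

locale slot_load =
  fixes F S :: "nat \<Rightarrow> real" and m :: nat
  assumes F0: "F 0 = 0" and Fm: "F m = 0" and F_nonneg: "\<And>i. 0 \<le> F i"
    and S_01: "\<And>j. S j = 0 \<or> S j = 1" and S0: "S 0 = 0" and Sm: "S (m - 1) = 0"
    and cap: "\<And>i. 0 < i \<Longrightarrow> i < m \<Longrightarrow> F i + (S (i - 1) + S i) / 2 \<le> 2"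
    and adj: "\<And>i. 0 < i \<Longrightarrow> Suc i < m \<Longrightarrow> 0 < F i \<Longrightarrow> 0 < F (Suc i) \<Longrightarrow> F i + F (Suc i) \<le> 1 \<and> S i = 0"
    and big: "real m - 1 < (\<Sum>i<m. F i) + (\<Sum>j<m. S j) / 2"
begin

definition G :: "nat \<Rightarrow> real" where
  "G i = F i + (S (i - 1) + S i) / 2"

definition kk :: "nat \<Rightarrow> real" where
  "kk i = (if 0 < F i then G i else 0)"

text \<open>A loaded position divides its load and the halves of the chords beside it evenly between
  its two slots; a chord with no loaded position beside it enters directly. The aim is that no slot
  exceeds 1.\<close>

definition y :: "nat \<Rightarrow> real" where
  "y j = (kk j + kk (Suc j)) / 2 + (if F j = 0 \<and> F (Suc j) = 0 then S j / 2 else 0)"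

lemma pos_cases: "F i = 0 \<or> 0 < F i"
  using F_nonneg[of i] by linarith

lemma S_le: "0 \<le> S j" "S j \<le> 1"
  using S_01[of j] by auto

lemma posD: "0 < F i \<Longrightarrow> i \<le> m \<Longrightarrow> 0 < i \<and> i < m"
  using F0 Fm by (metis le_neq_implies_less less_irrefl not_gr_zero)

lemma sum_y: "(\<Sum>j<m. y j) = (\<Sum>i<m. F i) + (\<Sum>j<m. S j) / 2"
proof -
  have shift: "(\<Sum>j<m. g (Suc j)) = (\<Sum>j<m. g j)" if "g 0 = 0" "g m = (0::real)" for g
    using sum.lessThan_Suc_shift[of g m] that by simp
  define u where "u i = (if 0 < F i then S (i - 1) else 0)" for i
  have u: "(\<Sum>j<m. u (Suc j)) = (\<Sum>j<m. u j)"
    by (rule shift) (use F0 Fm u_def in auto)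
  have k: "(\<Sum>j<m. kk (Suc j)) = (\<Sum>j<m. kk j)"
    by (rule shift) (use F0 Fm kk_def in auto)
  have kF: "kk j = F j + u j / 2 + (if 0 < F j then S j / 2 else 0)" for j
    using pos_cases[of j] unfolding kk_def G_def u_def by (auto simp: add_divide_distrib)
  \<comment> \<open>Every chord is counted once: a slot with loaded positions on both sides is empty
    by \<open>adj\<close>, and otherwise exactly one of the three terms carries
    \<open>S j / 2\<close>.\<close>
  have eq: "u (Suc j) / 2 + (if 0 < F j then S j / 2 else 0) + (if F j = 0 \<and> F (Suc j) = 0 then S j / 2 else 0) = S j / 2"
    if "j < m" for j
    using adj[of j] posD[of j] posD[of "Suc j"] that pos_cases[of j] pos_cases[of "Suc j"] unfolding u_def
    by auto
  have "(\<Sum>j<m. y j) = ((\<Sum>j<m. kk j) + (\<Sum>j<m. kk (Suc j))) / 2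
      + (\<Sum>j<m. if F j = 0 \<and> F (Suc j) = 0 then S j / 2 else 0)"
    unfolding y_def by (simp add: sum.distrib flip: sum_divide_distrib)
  also have "\<dots> = (\<Sum>j<m. kk j) + (\<Sum>j<m. if F j = 0 \<and> F (Suc j) = 0 then S j / 2 else 0)"
    using k by simp
  also have "\<dots> = (\<Sum>j<m. F j) + (\<Sum>j<m. u (Suc j)) / 2 + (\<Sum>j<m. if 0 < F j then S j / 2 else 0)
      + (\<Sum>j<m. if F j = 0 \<and> F (Suc j) = 0 then S j / 2 else 0)"
    unfolding kF u by (simp add: sum.distrib sum_divide_distrib)
  also have "\<dots> = (\<Sum>j<m. F j) + (\<Sum>j<m. u (Suc j) / 2 + (if 0 < F j then S j / 2 else 0) + (if F j = 0 \<and> F (Suc j) = 0 then S j / 2 else 0))"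
    by (simp only: sum.distrib sum_divide_distrib add.assoc)
  also have "(\<Sum>j<m. u (Suc j) / 2 + (if 0 < F j then S j / 2 else 0) + (if F j = 0 \<and> F (Suc j) = 0 then S j / 2 else 0)) = (\<Sum>j<m. S j / 2)"
    by (rule sum.cong) (use eq in auto)
  finally show ?thesis
    by (simp add: sum_divide_distrib)
qed

lemma kk_le: "i \<le> m \<Longrightarrow> kk i \<le> 2"
  using cap[of i] posD[of i] unfolding kk_def G_def by auto

lemma adj_G:
  assumes "j < m" "0 < F j" "0 < F (Suc j)"
  shows "S j = 0" "F j + F (Suc j) \<le> 1" "G j + G (Suc j) \<le> 1 + (S (j - 1) + S (Suc j)) / 2"
  using adj[of j] posD[of j] posD[of "Suc j"] assms unfolding G_def by (auto simp: add_divide_distrib)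

lemma y_le: "j < m \<Longrightarrow> y j \<le> 1"
  using kk_le[of j] kk_le[of "Suc j"] adj_G[of j] S_le[of "j - 1"] S_le[of "Suc j"] S_le[of j]
    pos_cases[of j] pos_cases[of "Suc j"]
  unfolding y_def by (auto simp: kk_def add_divide_distrib)

text \<open>By \<open>big\<close> the slots together miss their maximum \<open>m\<close> by less
  than 1. Any set of slots that falls short by 1 in total is therefore a contradiction.\<close>

lemma gain_lt: 
  assumes "B \<subseteq> {..<m}"
  shows "(\<Sum>j\<in>B. 1 - y j) < 1"
proof -
  have "(\<Sum>j\<in>B. 1 - y j) \<le> (\<Sum>j<m. 1 - y j)"
    by (rule sum_mono2) (use assms y_le in auto)
  also have "\<dots> < 1"
    using big sum_y by (simp add: sum_subtractf)
  finally show ?thesis .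
qed

lemma y_adj_le:
  assumes "j < m" "0 < F j \<and> 0 < F (j - 1) \<and> 0 < j \<or> 0 < F j \<and> F (Suc j) = 0 \<and> S (j - 1) = 0 \<and> F j \<le> 1
    \<or> 0 < F (Suc j) \<and> F j = 0 \<and> S (Suc j) = 0 \<and> F (Suc j) \<le> 1 \<or> 0 < F j \<and> 0 < F (Suc j) \<and> S (j - 1) = 0
    \<or> 0 < F j \<and> 0 < F (Suc j) \<and> S (Suc j) = 0"
  shows "y j \<le> 3 / 4"
proof -
  have "y j \<le> 3 / 4" if "0 < F j \<and> F (Suc j) = 0 \<and> S (j - 1) = 0 \<and> F j \<le> 1"
    using that S_le[of j] unfolding y_def kk_def G_def by auto
  moreover have "y j \<le> 3 / 4" if "0 < F (Suc j) \<and> F j = 0 \<and> S (Suc j) = 0 \<and> F (Suc j) \<le> 1"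
    using that S_le[of j] unfolding y_def kk_def G_def by auto
  moreover have "y j \<le> 3 / 4" if "0 < F j \<and> 0 < F (Suc j) \<and> (S (j - 1) = 0 \<or> S (Suc j) = 0)"
    using that adj_G[OF assms(1)] S_le[of "j - 1"] S_le[of "Suc j"] unfolding y_def kk_def by auto
  moreover have "S (j - 1) = 0 \<and> F j \<le> 1" if "0 < F j \<and> 0 < F (j - 1) \<and> 0 < j"
  proof -
    have "j - 1 < m" "Suc (j - 1) = j"
      using that assms(1) by auto
    then show ?thesis
      using that adj_G[of "j - 1"] by auto
  qed
  ultimately show ?thesis
    using assms(2) pos_cases[of "Suc j"] by blast
qed

text \<open>The four slots touching three consecutive loaded positions fall short by 1/4
  each.\<close>

lemma no_triple:
  assumes "Suc (Suc j) \<le> m" "0 < F j" "0 < F (Suc j)" "0 < F (Suc (Suc j))"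
  shows False
proof -
  have j: "0 < j" "Suc (Suc j) < m"
    using posD assms by auto
  have a1: "S j = 0" "F j + F (Suc j) \<le> 1" and a2: "S (Suc j) = 0" "F (Suc j) + F (Suc (Suc j)) \<le> 1"
    using adj_G[of j] adj_G[of "Suc j"] assms j by auto
  have "y (j - 1) \<le> 3 / 4"
    using a1 assms j pos_cases[of "j - 1"] F_nonneg[of "Suc j"] by (intro y_adj_le) auto
  moreover have "y j \<le> 3 / 4" "y (Suc j) \<le> 3 / 4"
    by (rule y_adj_le; use a1 a2 assms j in force)+
  moreover have "y (Suc (Suc j)) \<le> 3 / 4"
    using a2 assms j by (intro y_adj_le) auto
  moreover have "(\<Sum>j\<in>{j - 1, j, Suc j, Suc (Suc j)}. 1 - y j) < 1"
    using j by (intro gain_lt) auto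
  ultimately show False
    using j by (cases j) auto
qed

text \<open>With unloaded positions on both sides, the three slots touching the pair carry exactly
  \<open>G j + G (Suc j)\<close>, which is at most 2, and so fall short by 1.\<close>

lemma no_adj:
  assumes "j < m" "0 < F j" "0 < F (Suc j)"
  shows False
proof -
  have j: "0 < j" "Suc j < m"
    using posD[of j] posD[of "Suc j"] assms by auto
  have 1: "F (Suc (Suc j)) = 0"
    using no_triple[of j] assms j pos_cases by force
  have 2: "F (j - 1) = 0"
    using no_triple[of "j - 1"] assms j pos_cases by force
  have "(\<Sum>j\<in>{j - 1, j, Suc j}. 1 - y j) < 1"
    using j by (intro gain_lt) auto
  moreover have "(\<Sum>j\<in>{j - 1, j, Suc j}. 1 - y j) = (1 - y (j - 1)) + (1 - y j) + (1 - y (Suc j))"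
    using j by (cases j) auto
  moreover have "y (j - 1) = G j / 2" "y j = (G j + G (Suc j)) / 2" "y (Suc j) = G (Suc j) / 2"
    using 1 2 assms j unfolding y_def kk_def by auto
  ultimately show False
    using adj_G(3)[OF assms] S_le[of "j - 1"] S_le[of "Suc j"] unfolding add_divide_distrib by linarith
qed

text \<open>A slot between two unloaded positions carries at most 1/2, so there is at most one, and
  it holds a chord. It spends half of the allowance, which leaves less than 1/2 for the other
  positions. The estimate is given for two pairs of positions because the chord may start at either
  end of the path.\<close>

lemma slot_cases:
  obtains (alternating) "\<And>j. j < m \<Longrightarrow> 0 < F j \<longleftrightarrow> \<not> 0 < F (Suc j)"
  | (gap) b where "2 \<le> b" "b + 2 < m" "S b = 1" "F b = 0" "F (Suc b) = 0"
      "0 < F 1" "0 < F (b + 2)" "0 < F (b - 1)" "0 < F (m - 1)"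
      "(2 - G 1) + (2 - G (b + 2)) < 1 / 2" "(2 - G (m - 1)) + (2 - G (b - 1)) < 1 / 2"
proof (cases "\<exists>b<m. F b = 0 \<and> F (Suc b) = 0")
  case False
  then show ?thesis
    using alternating no_adj pos_cases by (metis less_irrefl)
next
  case True
  then obtain b where b: "b < m" "F b = 0" "F (Suc b) = 0"
    by blast
  have yb: "y b = S b / 2"
    using b unfolding y_def kk_def by simp
  have Sb: "S b = 1"
    using gain_lt[of "{b}"] S_01[of b] b yb by auto
  have b': "0 < b" "Suc b < m"
  proof -
    have "b \<noteq> 0" "b \<noteq> m - 1"
      using Sb S0 Sm by (metis zero_neq_one)+
    then show "0 < b" "Suc b < m"
      using b(1) by linarith+
  qed
  have other: "0 < F j \<or> 0 < F (Suc j)" if "j < m" "j \<noteq> b" for j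
  proof (rule ccontr)
    assume "\<not> (0 < F j \<or> 0 < F (Suc j))"
    then have "F j = 0" "F (Suc j) = 0"
      using pos_cases by auto
    then have "y j \<le> 1 / 2"
      using S_le[of j] unfolding y_def kk_def by simp
    then show False
      using gain_lt[of "{b, j}"] that b(1) yb Sb by simp
  qed
  have one: "F (Suc j) = 0 \<or> F j = 0" if "j < m" for j
    using no_adj[OF that] pos_cases by blast
  have F1: "0 < F 1" and Fm1: "0 < F (m - 1)"
    using other[of 0] other[of "m - 1"] F0 Fm b' by auto
  have b2: "2 \<le> b" "b + 2 < m"
  proof -
    have "b \<noteq> 1" "Suc b \<noteq> m - 1"
      using F1 Fm1 b by auto
    then show "2 \<le> b" "b + 2 < m"
      using b' by auto
  qed
  have Fb: "0 < F (b + 2)" "0 < F (b - 1)"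
    using other[of "Suc b"] other[of "b - 1"] b b2 by auto
  have z: "F 2 = 0" "F (b + 3) = 0" "F (m - 2) = 0" "F (b - 2) = 0"
    using one[of 1] one[of "b + 2"] one[of "m - 2"] one[of "b - 2"] F1 Fb Fm1 b2
    by (auto simp: numeral_2_eq_2 numeral_3_eq_3 Suc_diff_Suc)
  have "y 0 = G 1 / 2" "y 1 = G 1 / 2" "y (b + 1) = G (b + 2) / 2" "y (b + 2) = G (b + 2) / 2"
    using F0 z F1 Fb b unfolding y_def kk_def by (auto simp: numeral_2_eq_2 numeral_3_eq_3)
  moreover have "(\<Sum>j\<in>{0, 1, b, b + 1, b + 2}. 1 - y j) < 1"
    using b2 by (intro gain_lt) auto
  ultimately have A: "(2 - G 1) + (2 - G (b + 2)) < 1 / 2"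
    using b2 yb Sb by simp
  have "Suc (m - 1) = m" "Suc (m - 2) = m - 1" "Suc (b - 1) = b" "Suc (b - 2) = b - 1"
    using b2 by auto
  then have ys: "y (m - 1) = G (m - 1) / 2" "y (m - 2) = G (m - 1) / 2" "y (b - 1) = G (b - 1) / 2" "y (b - 2) = G (b - 1) / 2"
    using Fm z Fm1 Fb b unfolding y_def kk_def by auto
  have "(\<Sum>j\<in>{m - 1, m - 2, b, b - 1, b - 2}. 1 - y j) < 1"
    using b2 by (intro gain_lt) auto
  then have "(2 - G (m - 1)) + (2 - G (b - 1)) < 1 / 2"
  proof -
    have "m - 1 \<notin> {m - 2, b, b - 1, b - 2}" "m - 2 \<notin> {b, b - 1, b - 2}" "b \<notin> {b - 1, b - 2}" "b - 1 \<notin> {b - 2}"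
      using b2 by auto
    then have "(\<Sum>j\<in>{m - 1, m - 2, b, b - 1, b - 2}. 1 - y j)
      = (1 - y (m - 1)) + (1 - y (m - 2)) + (1 - y b) + (1 - y (b - 1)) + (1 - y (b - 2))"
      by simp
    then show ?thesis
      using \<open>(\<Sum>j\<in>{m - 1, m - 2, b, b - 1, b - 2}. 1 - y j) < 1\<close> yb Sb ys
      by linarith
  qed
  then show ?thesis
    using gap[of b] b2 Sb b F1 Fb Fm1 A by blast
qed

lemma alternating_sum:
  assumes alt: "\<And>j. j < m \<Longrightarrow> 0 < F j \<longleftrightarrow> \<not> 0 < F (Suc j)"
  shows "even m" "\<And>i. i \<le> m \<Longrightarrow> 0 < F i \<longleftrightarrow> odd i"
    "(\<Sum>a<m div 2. 2 - G (2 * a + 1)) = real m - ((\<Sum>i<m. F i) + (\<Sum>j<m. S j) / 2)"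
    "\<And>i. odd i \<Longrightarrow> i < m \<Longrightarrow> G i \<le> 2"
proof -
  show odd: "0 < F i \<longleftrightarrow> odd i" if "i \<le> m" for i
    using that
  proof (induction i)
    case 0
    then show ?case using F0 by simp
  next
    case (Suc i)
    then show ?case using alt[of i] by auto
  qed
  from this[of m] Fm show "even m"
    by auto
  then obtain k where k: "m = 2 * k"
    by blast
  have pair: "(\<Sum>i<2 * k. g i) = (\<Sum>a<k. g (2 * a) + g (2 * a + 1))" for g :: "nat \<Rightarrow> real"
    by (induction k) auto
  have "F (2 * a) = 0" if "a < k" for a
    using odd[of "2 * a"] pos_cases[of "2 * a"] that k by auto
  then have "(\<Sum>i<m. F i) = (\<Sum>a<k. F (2 * a + 1))"
    unfolding k pair by (intro sum.cong) auto
  moreover have "(\<Sum>j<m. S j) / 2 = (\<Sum>a<k. (S (2 * a) + S (2 * a + 1)) / 2)"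
    unfolding k pair by (simp add: sum_divide_distrib)
  ultimately show "(\<Sum>a<m div 2. 2 - G (2 * a + 1)) = real m - ((\<Sum>i<m. F i) + (\<Sum>j<m. S j) / 2)"
    unfolding k G_def by (simp add: sum_subtractf sum.distrib)
  show "G i \<le> 2" if "odd i" "i < m" for i
    using cap[of i] that odd_pos[of i] unfolding G_def by auto
qed

end

section \<open>Hits and load edges\<close>

locale optimal = six_regular +
  fixes P assumes opt: "opt P"
begin

lemmas pp = optD[OF opt]

definition comp_of :: "'a \<Rightarrow> 'a list" where
  "comp_of v = (THE p. p \<in># P \<and> v \<in> set p)"

lemma comp_of_eq: "p \<in># P \<Longrightarrow> v \<in> set p \<Longrightarrow> comp_of v = p"
  unfolding comp_of_def using ppart_same[OF pp] by blast

lemma comp_of_in: "v \<in> V \<Longrightarrow> comp_of v \<in># P \<and> v \<in> set (comp_of v)"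
  using comp_of_eq ppart_cover[OF pp] by metis

lemma pthP: "p \<in># P \<Longrightarrow> pth p"
  using ppart_pth[OF pp] .

lemma ends_setP: "p \<in># P \<Longrightarrow> ends p \<subseteq> set p"
  using pthP[of p] ends_sub[of p] by (auto simp: pth_def)

lemma lengths: "p \<in># P \<Longrightarrow> cyc p \<or> length p = 2 \<or> 4 \<le> length p"
proof -
  assume p: "p \<in># P"
  have "cyc p \<or> length p \<noteq> 1 \<and> length p \<noteq> 3"
    using no_odd_piece[OF opt p refl] by blast
  moreover have "length p \<noteq> 0"
    using pthP[OF p] by auto
  ultimately show ?thesis
    by linarith
qed

text \<open>The rate of a cycle serves two demands: its vertices collect enough for the cycle
  itself, and by \<open>nonham_card\<close> two sets of hitters without a Hamiltonian path between
  them are worth at most 1 together.\<close>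

definition hit_rate :: "'a list \<Rightarrow> real" where
  "hit_rate C = (if cyc C then 1 / length C else 1 / 2)"

lemma hit_rate_bounds: "0 < hit_rate C" "hit_rate C \<le> 1 / 2"
proof -
  have "3 \<le> length C" if "cyc C"
    using that by (simp add: cyc_def)
  then have "0 < length C" "1 / real (length C) \<le> 1 / 2" if "cyc C"
    using that frac_le[of 1 1 2 "real (length C)"] by force+
  then show "0 < hit_rate C" "hit_rate C \<le> 1 / 2"
    unfolding hit_rate_def by auto
qed

definition hits :: "'a list \<Rightarrow> 'a \<Rightarrow> 'a set" where
  "hits Q v = {x. E v x \<and> (\<exists>C\<in>#P. C \<noteq> Q \<and> x \<in> ends C)}"

lemma hits_iff: "x \<in> hits Q v \<longleftrightarrow> E v x \<and> comp_of x \<noteq> Q \<and> x \<in> ends (comp_of x)"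
proof
  assume "x \<in> hits Q v"
  then obtain C where "E v x" "C \<in># P" "C \<noteq> Q" "x \<in> ends C"
    unfolding hits_def by blast
  moreover from this have "comp_of x = C"
    using comp_of_eq[of C x] ends_setP[of C] by blast
  ultimately show "E v x \<and> comp_of x \<noteq> Q \<and> x \<in> ends (comp_of x)"
    by simp
next
  assume "E v x \<and> comp_of x \<noteq> Q \<and> x \<in> ends (comp_of x)"
  moreover from this have "comp_of x \<in># P"
    using E_V comp_of_in by blast
  ultimately show "x \<in> hits Q v"
    unfolding hits_def by blast
qed

lemma hits_sub: "hits Q v \<subseteq> nbs v"
  unfolding hits_def by auto

lemma fin_hits [simp]: "finite (hits Q v)"
  by (rule finite_subset[OF hits_sub fin_nbs])

definition hit_weight :: "'a list \<Rightarrow> 'a \<Rightarrow> real" where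
  "hit_weight Q v = (\<Sum>x\<in>hits Q v. hit_rate (comp_of x))"

lemma hit_weight_pos: "hits Q v \<noteq> {} \<Longrightarrow> 0 < hit_weight Q v"
  unfolding hit_weight_def using hits_iff E_V comp_of_in hit_rate_bounds by (intro sum_pos) auto

lemma hit_weight_le: "hit_weight Q v \<le> card (hits Q v) / 2"
  unfolding hit_weight_def using sum_bounded_above[of "hits Q v" "\<lambda>x. hit_rate (comp_of x)" "1/2"] hit_rate_bounds(2) by simp

lemma ham_ends:
  assumes "C \<in># P" "\<not> cyc C" "x \<in> ends C" "y \<in> ends C" "x \<noteq> y"
  shows "ham C x y"
proof -
  have "x = hd C \<and> y = last C \<or> x = hd (rev C) \<and> y = last (rev C)"
    using assms by (auto simp: ends_def hd_rev last_rev)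
  then show ?thesis
    unfolding ham_def using pthP[OF assms(1)] by (metis mset_rev pth_rev)
qed

lemma ham_cyc:
  assumes "C \<in># P" "cyc C" "i < length C"
  shows "ham C (C ! i) (C ! (Suc i mod length C))"
proof (cases "Suc i = length C")
  case True
  then have "C ! i = hd (rev C)" "C ! (Suc i mod length C) = last (rev C)"
    using pthP[OF assms(1)] by (auto simp: hd_rev last_rev last_conv_nth hd_conv_nth pth_def simp flip: True)
  then show ?thesis
    unfolding ham_def using pthP[OF assms(1)] by (metis mset_rev pth_rev)
next
  case False
  then have i: "Suc i < length C"
    using assms by auto
  let ?p = "rev (take (Suc i) C) @ rev (drop (Suc i) C)"
  have "pth ?p"
    using pthP[OF assms(1)] i assms(2) E_sym pth_take[of C "Suc i"] pth_drop[of C "Suc i"]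
    by (intro pth_append) (auto simp: last_rev hd_rev hd_take cyc_def)
  moreover have "mset ?p = mset C"
    using mset_take_drop[of "Suc i" C] by simp
  moreover have "hd ?p = C ! i" "last ?p = C ! Suc i"
    using i last_take_Suc[of i C] pthP[OF assms(1)] by (auto simp: hd_rev last_rev hd_drop_conv_nth hd_append)
  ultimately show ?thesis
    unfolding ham_def using i by auto
qed

text \<open>On a cycle, the successors of \<open>X\<close> avoid \<open>Y\<close>.\<close>

lemma nonham_card:
  assumes C: "C \<in># P" and XY: "X \<subseteq> ends C" "Y \<subseteq> ends C" "X \<noteq> {}" "Y \<noteq> {}"
    and nh: "\<And>x y. x \<in> X \<Longrightarrow> y \<in> Y \<Longrightarrow> \<not> ham C x y"
  shows "hit_rate C * (card X + card Y) \<le> 1"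
proof (cases "cyc C")
  case False
  then have "x = y" if "x \<in> X" "y \<in> Y" for x y
    using ham_ends[OF C] nh that XY by blast
  then obtain x where "X = {x}" "Y = {x}"
    using XY by blast
  then show ?thesis
    using False by (simp add: hit_rate_def)
next
  case True
  let ?k = "length C"
  let ?I = "{i. i < ?k \<and> C ! i \<in> X}" and ?J = "{i. i < ?k \<and> C ! i \<in> Y}"
  let ?s = "\<lambda>i. Suc i mod ?k"
  have k: "0 < ?k"
    using True by (auto simp: cyc_def)
  have dC: "distinct C"
    using ppart_distinct[OF pp C] .
  have card: "card {i. i < ?k \<and> C ! i \<in> Z} = card Z" if "Z \<subseteq> set C" for Z
  proof -
    have "bij_betw ((!) C) {i. i < ?k \<and> C ! i \<in> Z} Z"
      using that dC unfolding bij_betw_def inj_on_def by (auto simp: nth_eq_iff_index_eq in_set_conv_nth image_iff subset_iff)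
    then show ?thesis
      by (rule bij_betw_same_card)
  qed
  have XYs: "X \<subseteq> set C" "Y \<subseteq> set C"
    using XY ends_setP[OF C] by auto
  have "inj_on ?s {..<?k}"
  proof (rule inj_onI)
    fix i j assume "i \<in> {..<?k}" "j \<in> {..<?k}" "?s i = ?s j"
    then show "i = j"
      by (cases "Suc i = ?k"; cases "Suc j = ?k") (auto simp: mod_Suc split: if_splits)
  qed
  then have "card (?s ` ?I) = card ?I"
    by (intro card_image) (auto elim: inj_on_subset)
  moreover have "?s ` ?I \<inter> ?J = {}"
    using nh ham_cyc[OF C True] by force
  then have "card (?s ` ?I \<union> ?J) = card (?s ` ?I) + card ?J"
    by (intro card_Un_disjoint) auto
  moreover have "card (?s ` ?I \<union> ?J) \<le> card {..<?k}"
    using k by (intro card_mono) auto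
  ultimately have "card X + card Y \<le> ?k"
    using card XYs by simp
  then show ?thesis
    using True k by (simp add: hit_rate_def field_simps)
qed

lemma hit_end:
  assumes "Q \<in># P" "pth q" "mset q = mset Q" "v \<in> {hd q, last q}"
  shows "hits Q v = {}"
proof (rule ccontr)
  assume "hits Q v \<noteq> {}"
  then obtain x C where "E v x" "C \<in># P" "C \<noteq> Q" "x \<in> ends C"
    unfolding hits_def by blast
  then show False
    using no_attach[OF opt, of "{#Q#}" C q "{#}" v x] assms by (auto simp: in_diff_count)
qed

text \<open>\<open>attach_pair\<close> puts all hitters of both vertices on a single component and
  denies every pair a Hamiltonian path, which is the situation of
  \<open>nonham_card\<close>.\<close>

lemma hits_pair:
  assumes Q: "Q \<in># P" and q: "pth q1" "pth q2" "mset q1 + mset q2 = mset Q"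
    "v \<in> {hd q1, last q1}" "w \<in> {hd q2, last q2}" and h: "hits Q v \<noteq> {}" "hits Q w \<noteq> {}"
  shows "hit_weight Q v + hit_weight Q w \<le> 1"
proof -
  have *: "comp_of x = comp_of y \<and> \<not> ham (comp_of x) x y" if "x \<in> hits Q v" "y \<in> hits Q w" for x y
  proof -
    have "comp_of x \<in># P - {#Q#}" "comp_of y \<in># P - {#Q#}"
      using that hits_iff E_V comp_of_in by (auto simp: in_diff_count)
    then show ?thesis
      using attach_pair[OF opt, of "{#Q#}" "comp_of x" "comp_of y" q1 q2 "{#}" v w x y] Q q that hits_iff by auto
  qed
  obtain x0 where x0: "x0 \<in> hits Q v"
    using h by blast
  define C where "C = comp_of x0"
  have C: "C \<in># P"
    using x0 E_V comp_of_in hits_iff unfolding C_def by blast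
  have y: "comp_of y = C" if "y \<in> hits Q w" for y
    using *[OF x0 that] C_def by simp
  have x: "comp_of x = C" if "x \<in> hits Q v" for x
    using *[OF that] y h by blast
  have "hit_weight Q v = hit_rate C * card (hits Q v)" "hit_weight Q w = hit_rate C * card (hits Q w)"
    unfolding hit_weight_def using x y by simp_all
  moreover have "hit_rate C * (card (hits Q v) + card (hits Q w)) \<le> 1"
  proof (rule nonham_card[OF C _ _ h])
    show "hits Q v \<subseteq> ends C"
      using x hits_iff[of _ Q v] by (metis subsetI)
    show "hits Q w \<subseteq> ends C"
      using y hits_iff[of _ Q w] by (metis subsetI)
    show "\<not> ham C a b" if "a \<in> hits Q v" "b \<in> hits Q w" for a b
      using *[OF that] unfolding x[OF that(1)] by blast
  qed
  ultimately show ?thesis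
    by (simp add: algebra_simps)
qed

section \<open>Orientations, rotations and chords of a path\<close>

definition ori :: "'a list \<Rightarrow> 'a list \<Rightarrow> bool" where
  "ori Q q \<longleftrightarrow> q = Q \<or> q = rev Q"

lemma ori_facts:
  assumes "ori Q q" "Q \<in># P"
  shows "pth q" "mset q = mset Q" "set q = set Q" "length q = length Q" "distinct q" "ends q = ends Q"
    "cyc q = cyc Q" "ori Q (rev q)" "q \<noteq> []"
  using assms pthP[OF assms(2)] ppart_distinct[OF pp assms(2)] ends_rev[of Q] cyc_rev[of Q]
  unfolding ori_def by auto

lemma ori_refl [simp]: "ori Q Q" "ori Q (rev Q)"
  by (auto simp: ori_def)

text \<open>A Posa rotation.\<close>

lemma rotate_pth:
  assumes "pth q" "Suc i < length q" "E (q ! 0) (q ! Suc i)"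
  shows "pth (rev (take (Suc i) q) @ drop (Suc i) q)" "mset (rev (take (Suc i) q) @ drop (Suc i) q) = mset q"
    "hd (rev (take (Suc i) q) @ drop (Suc i) q) = q ! i"
proof -
  have "hd q = q ! 0"
    using assms(1) by (cases q) auto
  then show "pth (rev (take (Suc i) q) @ drop (Suc i) q)"
    using assms pth_take[of q "Suc i"] pth_drop[of q "Suc i"]
    by (intro pth_append) (auto simp: last_rev hd_take hd_drop_conv_nth)
  show "mset (rev (take (Suc i) q) @ drop (Suc i) q) = mset q"
    using mset_take_drop[of "Suc i" q] by simp
  show "hd (rev (take (Suc i) q) @ drop (Suc i) q) = q ! i"
  proof -
    have "take (Suc i) q \<noteq> []"
      using assms(2) by auto
    then show ?thesis
      using assms(2) last_take_Suc[of i q] by (simp add: hd_rev)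
  qed
qed

lemma hit_chord:
  assumes "Q \<in># P" "ori Q q" "Suc i < length q" "E (q ! 0) (q ! Suc i)"
  shows "hits Q (q ! i) = {}"
  using hit_end[OF assms(1) rotate_pth(1)[OF _ assms(3,4)], of "q ! i"] rotate_pth[OF _ assms(3,4)]
    ori_facts[OF assms(2,1)] by auto

text \<open>As in the proof of Dirac's theorem, crossing chords from the two ends close the path to
  a cycle on the same vertices. Then \<open>open_count\<close> drops while the other two measures
  stay.\<close>

lemma no_crossing:
  assumes "Q \<in># P" "ori Q q" "\<not> cyc Q" "3 \<le> length q" "Suc j < length q" "E (q ! 0) (q ! Suc j)" "E (last q) (q ! j)"
  shows False
proof -
  note o = ori_facts[OF assms(2,1)]
  let ?n = "take (Suc j) q @ rev (drop (Suc j) q)"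
  have "pth ?n"
    using o assms pth_take[of q "Suc j"] pth_drop[of q "Suc j"] last_take_Suc[of j q] E_sym
    by (intro pth_append) (auto simp: hd_rev)
  moreover have m: "mset ?n = mset Q"
    using o mset_take_drop[of "Suc j" q] by simp
  moreover have "cyc ?n"
  proof -
    have "hd ?n = q ! 0"
      using o(9) by (cases q) auto
    moreover have "last ?n = q ! Suc j"
      using assms(5) by (simp add: last_rev hd_drop_conv_nth)
    ultimately show ?thesis
      using assms(4,6) E_sym unfolding cyc_def by simp
  qed
  ultimately have "better {#?n#} {#Q#}" "\<not> better {#?n#} {#Q#}"
    using exchange[OF opt, of "{#Q#}" "{#?n#}"] mset_eq_length[OF m] assms o by (auto simp: better_def)
  then show False
    by blast
qed

text \<open>The second condition excludes the only way in which two hitters of \<open>v\<close> and a hitter of another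
  vertex can all fail to be joined by a Hamiltonian path of their common component.\<close>

definition rich :: "'a list \<Rightarrow> 'a \<Rightarrow> bool" where
  "rich Q v \<longleftrightarrow> (\<exists>x y. x \<noteq> y \<and> x \<in> hits Q v \<and> y \<in> hits Q v)
    \<and> \<not> (\<exists>C\<in>#P. even (length C) \<and> cyc C \<and> hits Q v \<subseteq> set C)"

text \<open>Five vertices guarantee that the third one is not an end. Richness of
  \<open>q ! 1\<close> is what lets \<open>q ! 0\<close> and \<open>q ! 1\<close> move to another
  component.\<close>

definition emits :: "'a list \<Rightarrow> 'a \<Rightarrow> bool" where
  "emits Q a \<longleftrightarrow> odd (length Q) \<and> 5 \<le> length Q \<and> \<not> cyc Q \<and> (\<exists>q. ori Q q \<and> a = q ! 2 \<and> rich Q (q ! 1))"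

lemma ori_U:
  assumes "Q \<in># P" "ori Q q" "\<not> cyc Q" "i < length q"
  shows "q ! i \<in> ends Q \<longleftrightarrow> i = 0 \<or> Suc i = length q"
proof -
  note o = ori_facts[OF assms(2,1)]
  have "q ! i \<in> ends q \<longleftrightarrow> q ! i = q ! 0 \<or> q ! i = q ! (length q - 1)"
    using assms(3) o by (auto simp: ends_def hd_conv_nth last_conv_nth)
  also have "\<dots> \<longleftrightarrow> i = 0 \<or> i = length q - 1"
  proof -
    have "0 < length q"
      using o by auto
    then show ?thesis
      using o(5) assms(4) by (auto simp: nth_eq_iff_index_eq)
  qed
  finally show ?thesis
    using o(6) assms(4) by auto
qed

lemma odd_hit_ori:
  assumes "Q \<in># P" "ori Q q" "C \<in># P" "C \<noteq> Q" "odd (length C)" "x \<in> ends C" "j < length q" "E (q ! j) x"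
  shows "odd j" "odd (length q)"
proof -
  have sub: "{#C, Q#} \<subseteq># P"
    by (rule two_sub[OF assms(3,1,4)])
  have "odd j \<and> odd (length q)"
  proof (cases "q = Q")
    case True
    then show ?thesis
      using odd_hit(1,2)[OF opt sub assms(6,5), of j] assms E_sym by blast
  next
    case False
    then have q: "q = rev Q"
      using assms(2) by (auto simp: ori_def)
    then have "E x (Q ! (length Q - Suc j))"
      using assms(7,8) E_sym by (simp add: rev_nth)
    then have "odd (length Q - Suc j)" "odd (length Q)"
      using odd_hit(1,2)[OF opt sub assms(6,5), of "length Q - Suc j"] assms(7) q by auto
    then show ?thesis
      using assms(7) q by auto
  qed
  then show "odd j" "odd (length q)"
    by auto
qed

end

text \<open>\<open>q ! 2\<close> becomes the end of a path as soon as \<open>q ! 1\<close> is attached to a component that hits it.\<close>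

locale load_edge = optimal +
  fixes Qs Q q p i
  assumes Qs: "Qs \<in># P" and Q: "Q \<in># P" and ne: "Qs \<noteq> Q" and q: "ori Qs q" and p: "ori Q p"
    and odd_s: "odd (length Qs)" and len: "5 \<le> length Qs" and nc: "\<not> cyc Qs" "\<not> cyc Q"
    and rich: "rich Qs (q ! 1)" and i: "0 < i" "Suc i < length p" and edge: "E (q ! 2) (p ! i)"
begin

lemmas oq = ori_facts[OF q Qs] and op = ori_facts[OF p Q]

lemma reversed: "load_edge V E P Qs Q q (rev p) (length p - Suc i)"
  using i op(8) edge
  by unfold_locales (use Qs Q ne q odd_s len nc rich in \<open>auto simp: rev_nth\<close>)

lemma sub: "{#Qs, Q#} \<subseteq># P"
  by (rule two_sub[OF Qs Q ne])

lemma take2: "pth (take 2 q)" "last (take 2 q) = q ! 1" "hd (take 2 q) = q ! 0" "length (take 2 q) = 2"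
  using pth_take[of q 2] last_take_Suc[of 1 q] oq len
  by (auto simp: hd_take hd_conv_nth numeral_2_eq_2)

lemma drop2: "pth (drop 2 q)" "hd (drop 2 q) = q ! 2" "length (drop 2 q) = length Qs - 2"
  using pth_drop[of q 2] oq len by (auto simp: hd_drop_conv_nth)

lemma takei: "pth (take (Suc i) p)" "last (take (Suc i) p) = p ! i" "hd (take (Suc i) p) = p ! 0"
  "length (take (Suc i) p) = Suc i"
  using pth_take[of p "Suc i"] last_take_Suc[of i p] op i by (auto simp: hd_take hd_conv_nth)

lemma dropi: "pth (drop (Suc i) p)" "hd (drop (Suc i) p) = p ! Suc i" "last (drop (Suc i) p) = last p"
  "length (drop (Suc i) p) = length p - Suc i"
  using pth_drop[of p "Suc i"] op i by (auto simp: hd_drop_conv_nth)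

lemma joint: "pth (rev (drop 2 q) @ rev (take (Suc i) p))"
  using takei drop2 edge by (intro pth_append) (auto simp: last_rev hd_rev)

lemma msets: "mset (take 2 q) + mset (drop 2 q) = mset Qs" "mset (take (Suc i) p) + mset (drop (Suc i) p) = mset Q"
  using mset_take_drop oq op by metis+

lemma hitterE:
  assumes "x \<in> hits Qs (q ! 1)"
  obtains C where "C \<in># P" "C \<noteq> Qs" "x \<in> ends C" "E (q ! 1) x"
  using assms unfolding hits_def by blast

lemma outside:
  assumes "C \<in># P" "C \<noteq> Qs" "C \<noteq> Q"
  shows "C \<in># P - {#Qs, Q#}"
  using assms by (simp add: in_diff_count)

text \<open>Three paths replace three: \<open>C\<close> receives \<open>q ! 0\<close> and
  \<open>q ! 1\<close>, the rest of \<open>q\<close> continues along the edge into \<open>p\<close>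
  and back to its start, and the tail of \<open>p\<close> is left over.\<close>

lemma odd_cost_three:
  assumes "x \<in> ends C" "E (q ! 1) x" "C \<in># P" "C \<noteq> Qs" "C \<noteq> Q"
  shows "odd_weight (length C) + odd_weight (length Qs) + odd_weight (length p)
    \<le> odd_weight (length C + 2) + odd_weight (length Qs - 2 + Suc i) + odd_weight (length p - Suc i)"
    and "length C + length Qs + length p \<le> card V"
proof -
  have s: "add_mset C {#Qs, Q#} \<subseteq># P"
    using sub_addI[OF sub outside] assms by blast
  obtain c where c: "pth c" "mset c = mset C" "hd c = x"
    using ends_start[OF pthP[OF assms(3)] assms(1)] by blast
  have "pth (rev c @ rev (take 2 q))"
    using c take2 assms(2) E_sym by (intro pth_append) (auto simp: last_rev hd_rev)
  then have "odd_cost (add_mset C {#Qs, Q#}) \<le> odd_cost {#rev c @ rev (take 2 q), rev (drop 2 q) @ rev (take (Suc i) p), drop (Suc i) p#}"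
    using joint dropi(1) msets c by (intro odd_cost_le[OF opt s]) (auto simp: ac_simps)
  then show "odd_weight (length C) + odd_weight (length Qs) + odd_weight (length p)
    \<le> odd_weight (length C + 2) + odd_weight (length Qs - 2 + Suc i) + odd_weight (length p - Suc i)"
    using mset_eq_length[OF c(2)] take2(4) drop2(3) takei(4) dropi(4) op(4) by (simp add: min_def)
  show "length C + length Qs + length p \<le> card V"
    using ppart_size[OF pp s] op(4) by simp
qed

text \<open>For the case that \<open>q ! 1\<close> is hit by an end of \<open>Q\<close> itself.
  Either the start of \<open>p\<close> is inserted between \<open>q ! 1\<close> and
  \<open>q ! 2\<close>, or \<open>p\<close> is cut before position \<open>i\<close> and its two
  parts go to the two parts of \<open>q\<close>.\<close>

lemma hd_cover:
  assumes "E (q ! 1) (p ! 0)"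
  shows "pth (take 2 q @ take (Suc i) p @ drop 2 q)" "pth (take 2 q @ take i p)" "pth (rev (drop 2 q) @ drop i p)"
proof -
  have "pth (take (Suc i) p @ drop 2 q)"
    using takei drop2 edge E_sym by (intro pth_append) auto
  moreover have "hd (take (Suc i) p @ drop 2 q) = p ! 0"
    using takei by (metis hd_append pth_Nil)
  ultimately show "pth (take 2 q @ take (Suc i) p @ drop 2 q)"
    using take2 assms by (intro pth_append[OF take2(1)]) auto
  have "hd (take i p) = p ! 0"
    using i op by (simp add: hd_take hd_conv_nth)
  then show "pth (take 2 q @ take i p)"
    using take2 assms pth_take[of p i] i op by (intro pth_append) auto
  have "hd (drop i p) = p ! i"
    using i by (simp add: hd_drop_conv_nth)
  then show "pth (rev (drop 2 q) @ drop i p)"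
    using drop2 edge pth_drop[of p i] i op by (intro pth_append) (auto simp: last_rev)
qed

lemma odd_cost_two:
  assumes "E (q ! 1) (p ! 0)"
  shows "odd_weight (length Qs) + odd_weight (length p) \<le> odd_weight (length Qs + Suc i) + odd_weight (length p - Suc i)"
    "odd_weight (length Qs) + odd_weight (length p) \<le> odd_weight (2 + i) + odd_weight (length Qs - 2 + (length p - i))"
    "length Qs + length p \<le> card V"
proof -
  have l: "length (take 2 q @ take (Suc i) p @ drop 2 q) = length Qs + Suc i"
    using take2(4) drop2(3) takei(4) len unfolding length_append by linarith
  have "odd_cost {#Qs, Q#} \<le> odd_cost {#take 2 q @ take (Suc i) p @ drop 2 q, drop (Suc i) p#}"
    using hd_cover(1)[OF assms] dropi(1) msets by (intro odd_cost_le[OF opt sub]) (auto simp: ac_simps)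
  then show "odd_weight (length Qs) + odd_weight (length p) \<le> odd_weight (length Qs + Suc i) + odd_weight (length p - Suc i)"
    unfolding odd_cost_simps l using dropi(4) op(4) by simp
  have "mset (take i p) + mset (drop i p) = mset Q"
    using mset_take_drop op by metis
  then have "odd_cost {#Qs, Q#} \<le> odd_cost {#take 2 q @ take i p, rev (drop 2 q) @ drop i p#}"
    using hd_cover(2,3)[OF assms] msets(1) by (intro odd_cost_le[OF opt sub]) (auto simp: ac_simps)
  then show "odd_weight (length Qs) + odd_weight (length p) \<le> odd_weight (2 + i) + odd_weight (length Qs - 2 + (length p - i))"
    using take2(4) drop2(3) op(4) i by (simp add: min_def)
  show "length Qs + length p \<le> card V"
    using ppart_size[OF pp sub] op(4) by simp
qed

lemma odd_weight_mono2: "k + 2 \<le> card V \<Longrightarrow> odd_weight (k + 2) \<le> odd_weight k"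
  using odd_weight_le[of k "k + 2"] by (cases "odd k") auto

text \<open>Two more vertices never raise the weight of \<open>C\<close>, so the positive weight of
  \<open>Qs\<close> must reappear in the two other pieces. On an odd path, even \<open>i\<close>
  makes both of them even; on an even path, odd \<open>i > 1\<close> makes the only odd one at least
  two longer than \<open>Qs\<close>.\<close>

lemma pos_three:
  assumes "x \<in> ends C" "E (q ! 1) x" "C \<in># P" "C \<noteq> Qs" "C \<noteq> Q"
  shows "odd (length p) \<Longrightarrow> odd i" "even (length p) \<Longrightarrow> odd i \<Longrightarrow> i = 1"
proof -
  note k = odd_cost_three[OF assms]
  have c: "odd_weight (length C + 2) \<le> odd_weight (length C)"
    using k(2) len by (intro odd_weight_mono2) auto
  have s: "0 < odd_weight (length Qs)"
    using odd_weight_pos odd_s by blast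
  show "odd i" if o: "odd (length p)"
  proof (rule ccontr)
    assume "\<not> odd i"
    then have "even (length Qs - 2 + Suc i)" "even (length p - Suc i)"
      using o odd_s len i by auto
    then show False
      using k(1) c s by simp
  qed
  show "i = 1" if e: "even (length p)" "odd i"
  proof (rule ccontr)
    assume "i \<noteq> 1"
    then have "length Qs + 2 \<le> length Qs - 2 + Suc i"
      using e(2) len by (auto elim!: oddE)
    then have "4 * odd_weight (length Qs - 2 + Suc i) \<le> odd_weight (length Qs)"
      using odd_weight_le[OF odd_s, of "length Qs - 2 + Suc i"] k(2) i len by simp
    moreover have "even (length p - Suc i)"
      using e i by auto
    ultimately show False
      using k(1) c s by simp
  qed
qed

text \<open>The first cover settles the parity of \<open>i\<close> on an odd path and excludes odd
  \<open>i\<close> on an even one. For even \<open>i\<close> on an even path, the second cover has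
  an odd piece at least two longer than \<open>Qs\<close> unless just two vertices of
  \<open>p\<close> remain from position \<open>i\<close> on.\<close>

lemma pos_two:
  assumes "E (q ! 1) (p ! 0)"
  shows "odd (length p) \<Longrightarrow> odd i" "even (length p) \<Longrightarrow> i + 2 = length p"
proof -
  note k = odd_cost_two[OF assms]
  have s: "0 < odd_weight (length Qs)"
    using odd_weight_pos odd_s by blast
  show "odd i" if o: "odd (length p)"
  proof (rule ccontr)
    assume "\<not> odd i"
    then have "even (length Qs + Suc i)" "even (length p - Suc i)"
      using o odd_s i by auto
    then show False
      using k(1) s by simp
  qed
  show "i + 2 = length p" if e: "even (length p)"
  proof (cases "odd i")
    case True
    then have "even (length p - Suc i)" "4 * odd_weight (length Qs + Suc i) \<le> odd_weight (length Qs)"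
      using e i odd_weight_le[OF odd_s, of "length Qs + Suc i"] k(3) by auto
    then show ?thesis
      using k(1) s by simp
  next
    case False
    show ?thesis
    proof (rule ccontr)
      assume "i + 2 \<noteq> length p"
      then have "4 \<le> length p - i"
        using False e i by presburger
      then have "4 * odd_weight (length Qs - 2 + (length p - i)) \<le> odd_weight (length Qs)"
        using odd_weight_le[OF odd_s, of "length Qs - 2 + (length p - i)"] k(3) len i by simp
      then show False
        using k(2) s False by simp
    qed
  qed
qed

lemma ex_hitter: "\<exists>x. x \<in> hits Qs (q ! 1)"
  using rich unfolding rich_def by blast

lemma ends_Q: "x \<in> ends Q \<longleftrightarrow> x = p ! 0 \<or> x = last p"
  using op nc by (metis ends_def hd_conv_nth insert_iff singletonD)

lemma load_position: "odd (length p) \<Longrightarrow> odd i" "even (length p) \<Longrightarrow> i = 1 \<or> i + 2 = length p"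
proof -
  \<comment> \<open>Reading \<open>p\<close> backwards covers a hitter that is the last vertex of
    \<open>p\<close>.\<close>
  interpret r: load_edge V E P Qs Q q "rev p" "length p - Suc i"
    by (rule reversed)
  obtain x C where C: "C \<in># P" "C \<noteq> Qs" "x \<in> ends C" "E (q ! 1) x"
    using ex_hitter hitterE by metis
  have "rev p ! 0 = last p"
    using op(9) by (simp add: rev_nth last_conv_nth)
  then have h: "x = p ! 0 \<or> x = rev p ! 0" if "C = Q"
    using ends_Q[of x] C(3) that by simp
  have ev: "even (length p - Suc i) \<longleftrightarrow> (even (length p) \<longleftrightarrow> odd i)"
    using i by auto
  show "odd i" if "odd (length p)"
    using that h C pos_three(1)[OF C(3,4,1,2)] pos_two(1) r.pos_two(1) ev by auto
  show "i = 1 \<or> i + 2 = length p" if "even (length p)"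
  proof (cases "C = Q")
    case True
    then show ?thesis
      using h that C pos_two(2) r.pos_two(2) i by auto
  next
    case False
    then show ?thesis
      using that pos_three(2)[OF C(3,4,1,2)] r.pos_three(2)[OF C(3,4,1,2)] ev i by (cases "odd i") auto
  qed
qed

text \<open>A hitter of the next vertex lies on an even component \<open>D\<close>, by parity. Every
  hitter of \<open>q ! 1\<close> must then lie on \<open>D\<close> without a Hamiltonian path to
  \<open>y\<close>. For an open \<open>D\<close> two hitters are too many, and an even cycle is just
  what \<open>rich\<close> excludes.\<close>

lemma load_next: "hits Q (p ! Suc i) = {}"
proof (rule ccontr)
  assume "hits Q (p ! Suc i) \<noteq> {}"
  then obtain y D where D: "D \<in># P" "D \<noteq> Q" "y \<in> ends D" "E (p ! Suc i) y"
    unfolding hits_def by blast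
  have eD: "even (length D)"
    using odd_hit_ori[OF Q p D(1,2) _ D(3) i(2) D(4)] load_position(1) by auto
  then have "D \<noteq> Qs"
    using odd_s by auto
  then have Do: "D \<in># P - {#Qs, Q#}"
    using outside D by blast
  have outX: "C \<noteq> Q" if "x \<in> ends C" "E (q ! 1) x" "C \<in># P" for x C
  proof
    assume "C = Q"
    then have "x = p ! 0 \<or> x = last p"
      using ends_Q[of x] that(1) by simp
    then show False
    proof
      assume "x = p ! 0"
      then have "pth (take 2 q @ take (Suc i) p @ drop 2 q)"
        using hd_cover(1) that(2) by simp
      then show False
        using no_attach[OF opt sub Do, of "drop (Suc i) p" "{#take 2 q @ take (Suc i) p @ drop 2 q#}" "p ! Suc i" y]
          dropi(1,2) msets D by (auto simp: ac_simps)
    next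
      assume "x = last p"
      then have "pth (take 2 q @ rev (drop (Suc i) p))"
        using take2 dropi that by (intro pth_append) (auto simp: hd_rev)
      moreover have "last (take 2 q @ rev (drop (Suc i) p)) = p ! Suc i"
        using dropi i by (simp add: last_rev)
      ultimately show False
        using no_attach[OF opt sub Do, of "take 2 q @ rev (drop (Suc i) p)" "{#rev (drop 2 q) @ rev (take (Suc i) p)#}" "p ! Suc i" y]
          joint msets D by (auto simp: ac_simps)
    qed
  qed
  have sameD: "x \<in> ends D \<and> \<not> ham D x y" if hx: "x \<in> hits Qs (q ! 1)" for x
  proof -
    obtain C where C: "C \<in># P" "C \<noteq> Qs" "x \<in> ends C" "E (q ! 1) x"
      by (rule hitterE[OF hx])
    then have Co: "C \<in># P - {#Qs, Q#}"
      using outX outside by blast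
    have "C = D \<and> \<not> ham C x y"
      using attach_pair[OF opt sub Co Do, of "take 2 q" "drop (Suc i) p" "{#rev (drop 2 q) @ rev (take (Suc i) p)#}" "q ! 1" "p ! Suc i" x y]
        take2 dropi joint msets C D by (auto simp: ac_simps)
    then show ?thesis
      using C by blast
  qed
  obtain x x' where x: "x \<noteq> x'" "x \<in> hits Qs (q ! 1)" "x' \<in> hits Qs (q ! 1)"
    using rich unfolding rich_def by blast
  show False
  proof (cases "cyc D")
    case True
    then have "hits Qs (q ! 1) \<subseteq> set D"
      using sameD ends_setP[OF D(1)] by auto
    then show False
      using rich eD True D(1) unfolding rich_def by auto
  next
    case False
    then show False
      using sameD[OF x(2)] sameD[OF x(3)] x(1) ham_ends[OF D(1) False _ D(3), of x]
        ham_ends[OF D(1) False _ D(3), of x'] by auto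
  qed
qed

text \<open>Rotating \<open>p\<close> along the chord exposes \<open>p ! i\<close>, so all of
  \<open>p\<close> can be appended to \<open>drop 2 q\<close>; the two vertices left over are
  absorbed by a hitter of \<open>q ! 1\<close>.\<close>

lemma load_chord: "\<not> E (p ! 0) (p ! Suc i)"
proof
  assume ch: "E (p ! 0) (p ! Suc i)"
  let ?p = "rev (take (Suc i) p) @ drop (Suc i) p"
  note rot = rotate_pth[OF op(1) i(2) ch]
  have j: "pth (rev (drop 2 q) @ ?p)"
    using drop2 edge rot by (intro pth_append[OF _ rot(1)]) (auto simp: last_rev)
  show False
  proof (cases "\<exists>x C. x \<in> ends C \<and> E (q ! 1) x \<and> C \<in># P \<and> C \<noteq> Qs \<and> C \<noteq> Q")
    case True
    then obtain x C where C: "x \<in> ends C" "E (q ! 1) x" "C \<in># P - {#Qs, Q#}"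
      using outside by blast
    show False
      using no_attach[OF opt sub C(3), of "take 2 q" "{#rev (drop 2 q) @ ?p#}" "q ! 1" x]
        take2 j rot msets C by (auto simp: ac_simps)
  next
    case False
    \<comment> \<open>Now all hitters of \<open>q ! 1\<close> are ends of \<open>Q\<close>. There
      are two of them, so one is \<open>last p\<close>, which the rotation keeps as an end.\<close>
    then have "hits Qs (q ! 1) \<subseteq> {p ! 0, last p}"
      using ends_Q unfolding hits_def by blast
    then have "E (q ! 1) (last p)"
      using rich unfolding rich_def hits_def by blast
    moreover have "last (rev (drop 2 q) @ ?p) = last p"
      using i by simp
    ultimately have "pth ((rev (drop 2 q) @ ?p) @ rev (take 2 q))"
      using take2 E_sym by (intro pth_append[OF j]) (auto simp: hd_rev)
    then have "\<not> better {#(rev (drop 2 q) @ ?p) @ rev (take 2 q)#} {#Qs, Q#}"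
      using rot msets by (intro exchange[OF opt sub]) (auto simp: ac_simps)
    then show False
      by (simp add: better_def)
  qed
qed

end

section \<open>Charges\<close>

context optimal
begin

definition loads :: "'a \<Rightarrow> 'a set" where
  "loads v = {a. E v a \<and> comp_of a \<noteq> comp_of v \<and> emits (comp_of a) a}"

text \<open>The charge \<open>charge u v\<close> flows along the edge from \<open>v\<close> to \<open>u\<close>.\<close>

definition charge :: "'a \<Rightarrow> 'a \<Rightarrow> real" where
  "charge u v = (if E u v \<and> comp_of u \<noteq> comp_of v \<and> v \<notin> ends (comp_of v)
    then if u \<in> ends (comp_of u) then hit_rate (comp_of u) else if emits (comp_of u) u then 1 / 4 else 0 else 0)"

text \<open>The names follow the hits and not the charge: \<open>inflow v\<close> is what
  \<open>v\<close> gives away, and \<open>outflow u\<close> is what \<open>u\<close>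
  collects.\<close>

definition inflow :: "'a \<Rightarrow> real" where
  "inflow v = (\<Sum>u\<in>V. charge u v)"

definition outflow :: "'a \<Rightarrow> real" where
  "outflow u = (\<Sum>v\<in>V. charge u v)"

lemma charge_nonneg: "0 \<le> charge u v"
  using hit_rate_bounds(1)[of "comp_of u"] by (auto simp: charge_def)

lemma outflow_nonneg: "0 \<le> outflow u" and inflow_nonneg: "0 \<le> inflow u"
  unfolding outflow_def inflow_def by (simp_all add: sum_nonneg charge_nonneg)

lemma emits_not_U:
  assumes "Q \<in># P" "emits Q a"
  shows "a \<notin> ends Q" "a \<in> set Q"
proof -
  obtain q where q: "ori Q q" "a = q ! 2" "5 \<le> length Q" "\<not> cyc Q"
    using assms(2) unfolding emits_def by blast
  note o = ori_facts[OF q(1) assms(1)]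
  show "a \<notin> ends Q"
    using ori_U[OF assms(1) q(1,4), of 2] q o by auto
  show "a \<in> set Q"
    using q o nth_mem[of 2 q] by auto
qed

lemma loads_iff: "v \<in> V \<Longrightarrow> a \<in> loads v \<longleftrightarrow> E v a \<and> comp_of a \<noteq> comp_of v \<and> emits (comp_of a) a \<and> a \<notin> ends (comp_of a)"
  unfolding loads_def using emits_not_U comp_of_in E_V by blast

lemma fin_loads [simp]: "finite (loads v)"
  by (rule finite_subset[OF _ fin_nbs[of v]]) (auto simp: loads_def)

lemma inflow_U: "Q \<in># P \<Longrightarrow> v \<in> set Q \<Longrightarrow> v \<in> ends Q \<Longrightarrow> inflow v = 0"
  unfolding inflow_def charge_def by (intro sum.neutral) (auto simp: comp_of_eq)

lemma inflow_eq:
  assumes "Q \<in># P" "v \<in> set Q" "v \<notin> ends Q"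
  shows "inflow v = hit_weight Q v + card (loads v) / 4"
proof -
  have Q: "comp_of v = Q" and v: "v \<in> V"
    using comp_of_eq ppart_subset[OF pp] assms by blast+
  have disj: "hits Q v \<inter> loads v = {}"
    using hits_iff loads_iff[OF v] by auto
  have "inflow v = (\<Sum>u\<in>hits Q v \<union> loads v. charge u v)"
    unfolding inflow_def
  proof (rule sum.mono_neutral_right)
    show "hits Q v \<union> loads v \<subseteq> V"
      using hits_iff loads_iff[OF v] E_V by blast
    show "\<forall>u\<in>V - (hits Q v \<union> loads v). charge u v = 0"
      using hits_iff[of _ Q v] loads_iff[OF v] E_sym[of _ v] Q unfolding charge_def by auto
  qed (rule finV)
  also have "\<dots> = (\<Sum>u\<in>hits Q v. charge u v) + (\<Sum>u\<in>loads v. charge u v)"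
    by (rule sum.union_disjoint) (use disj in auto)
  also have "(\<Sum>u\<in>hits Q v. charge u v) = hit_weight Q v"
    unfolding hit_weight_def by (rule sum.cong) (use hits_iff[of _ Q v] E_sym[of v] Q assms in \<open>auto simp: charge_def\<close>)
  also have "(\<Sum>u\<in>loads v. charge u v) = (\<Sum>u\<in>loads v. 1 / 4)"
    by (rule sum.cong) (use loads_iff[OF v] E_sym[of v] Q assms in \<open>auto simp: charge_def\<close>)
  finally show ?thesis
    by simp
qed

lemma flow_zero: "(\<Sum>v\<in>V. outflow v - inflow v) = 0"
  unfolding outflow_def inflow_def sum_subtractf using sum.swap[of charge V V] by simp

text \<open>\<open>hit_interior\<close> excludes an end on the other side, so no edge that leaves an
  end is wasted.\<close>

lemma ends_nb_out:
  assumes "Q \<in># P" "u \<in> ends Q" "E u v" "comp_of v \<noteq> Q"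
  shows "charge u v = hit_rate Q"
proof -
  have cu: "comp_of u = Q"
    using comp_of_eq[OF assms(1)] ends_setP[OF assms(1)] assms(2) by auto
  have v: "comp_of v \<in># P"
    using E_V[OF assms(3)] comp_of_in by blast
  have "v \<notin> ends (comp_of v)"
    by (rule hit_interior[OF opt two_sub[OF assms(1) v assms(4)[symmetric]] assms(2,3)])
  then show ?thesis
    using assms cu unfolding charge_def by auto
qed

lemma own_nbs:
  assumes "Q \<in># P" "u \<in> set Q"
  shows "card {v \<in> nbs u. comp_of v \<noteq> Q} + card {v \<in> set Q. E u v} = 6"
proof -
  let ?A = "{v \<in> nbs u. comp_of v \<noteq> Q}" and ?B = "{v \<in> set Q. E u v}"
  have un: "nbs u = ?A \<union> ?B"
  proof (intro equalityI subsetI)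
    fix v assume v: "v \<in> nbs u"
    then have "v \<in> set (comp_of v)"
      using E_V comp_of_in by auto
    with v show "v \<in> {v \<in> nbs u. comp_of v \<noteq> Q} \<union> {v \<in> set Q. E u v}"
      by auto
  qed auto
  have "?A \<inter> ?B = {}"
    by (auto dest: comp_of_eq[OF assms(1)])
  moreover have "finite ?A" "finite ?B"
    by (auto intro: finite_subset[OF _ fin_nbs[of u]])
  ultimately have "card (nbs u) = card ?A + card ?B"
    by (subst un, intro card_Un_disjoint)
  then show ?thesis
    using card_nbs[of u] ppart_subset[OF pp assms(1)] assms(2) by auto
qed

lemma outflow_ge:
  assumes "Q \<in># P" "u \<in> set Q" "\<And>v. v \<in> nbs u \<Longrightarrow> comp_of v \<noteq> Q \<Longrightarrow> w \<le> charge u v"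
  shows "w * (6 - real (card {v \<in> set Q. E u v})) \<le> outflow u"
proof -
  have "w * real (card {v \<in> nbs u. comp_of v \<noteq> Q}) \<le> (\<Sum>v\<in>{v \<in> nbs u. comp_of v \<noteq> Q}. charge u v)"
    using sum_bounded_below[of "{v \<in> nbs u. comp_of v \<noteq> Q}" w "charge u"] assms(3) by (simp add: mult.commute)
  also have "\<dots> \<le> outflow u"
    unfolding outflow_def using finV E_V by (intro sum_mono2) (auto simp: charge_nonneg)
  finally have "w * real (card {v \<in> nbs u. comp_of v \<noteq> Q}) \<le> outflow u" .
  moreover have "real (card {v \<in> nbs u. comp_of v \<noteq> Q}) = 6 - real (card {v \<in> set Q. E u v})"
    using own_nbs[OF assms(1,2)] by linarith
  ultimately show ?thesis
    by simp
qed

lemma outflow_end: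
  assumes "Q \<in># P" "u \<in> ends Q"
  shows "hit_rate Q * (6 - real (card {v \<in> set Q. E u v})) \<le> outflow u"
  using outflow_ge[OF assms(1), of u "hit_rate Q"] ends_nb_out[OF assms] ends_setP[OF assms(1)] assms(2) by auto

text \<open>The surplus of a component over its target 7.\<close>

definition val :: "'a list \<Rightarrow> real" where
  "val Q = real (length Q) - 7 + (\<Sum>v\<in>set Q. outflow v - inflow v)"

text \<open>Where every vertex is an end, nothing is paid, and each vertex has at most
  \<open>length Q - 1\<close> neighbours inside. For two-vertex paths and for cycles,
  \<open>w\<close> holds with equality.\<close>

lemma val_short:
  assumes Q: "Q \<in># P" and ends: "ends Q = set Q" and w: "7 - real (length Q) \<le> real (length Q) * (hit_rate Q * (6 - (real (length Q) - 1)))"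
  shows "0 \<le> val Q"
proof -
  have d: "distinct Q" 
    using ppart_distinct[OF pp Q] .
  have "(\<Sum>v\<in>set Q. hit_rate Q * (6 - (real (length Q) - 1))) \<le> (\<Sum>v\<in>set Q. outflow v - inflow v)"
  proof (rule sum_mono)
    fix u assume u: "u \<in> set Q"
    have "{v \<in> set Q. E u v} \<subseteq> set Q - {u}"
      using E_irr by auto
    then have "card {v \<in> set Q. E u v} \<le> card (set Q - {u})"
      by (intro card_mono) auto
    then have "real (card {v \<in> set Q. E u v}) \<le> real (length Q) - 1"
      using u d distinct_card[OF d] by (cases Q) auto
    then have "hit_rate Q * (6 - (real (length Q) - 1)) \<le> hit_rate Q * (6 - real (card {v \<in> set Q. E u v}))"
      using hit_rate_bounds(1)[of Q] by (intro mult_left_mono) auto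
    also have "\<dots> \<le> outflow u - inflow u"
      using outflow_end[OF Q] inflow_U[OF Q u] ends u by auto
    finally show "hit_rate Q * (6 - (real (length Q) - 1)) \<le> outflow u - inflow u" .
  qed
  then show ?thesis
    using w distinct_card[OF d] unfolding val_def by simp
qed

lemma val_cyc:
  assumes "Q \<in># P" "cyc Q"
  shows "0 \<le> val Q"
  using assms by (intro val_short) (auto simp: ends_def hit_rate_def cyc_def)

lemma val_two:
  assumes "Q \<in># P" "\<not> cyc Q" "length Q = 2"
  shows "0 \<le> val Q"
proof -
  obtain a b where "Q = [a, b]"
    using assms(3) by (auto simp: numeral_2_eq_2 length_Suc_conv)
  then show ?thesis
    using assms by (intro val_short) (auto simp: ends_def hit_rate_def)
qed

lemma load_edgeI:
  assumes Q: "Q \<in># P" "\<not> cyc Q" "ori Q p" "0 < i" "Suc i < length p" and a: "a \<in> loads (p ! i)"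
  obtains q where "load_edge V E P (comp_of a) Q q p i" "a = q ! 2"
proof -
  have "p ! i \<in> set Q"
    using ori_facts[OF Q(3,1)] Q(5) nth_mem[of i p] by auto
  then have "comp_of (p ! i) = Q"
    using comp_of_eq Q by blast
  then have a': "E (p ! i) a" "comp_of a \<noteq> Q" "emits (comp_of a) a" "comp_of a \<in># P"
    using a comp_of_in E_V unfolding loads_def by auto
  then obtain q where q: "ori (comp_of a) q" "a = q ! 2" "rich (comp_of a) (q ! 1)"
    unfolding emits_def by blast
  moreover have "E (q ! 2) (p ! i)"
    using a'(1) q(2) E_sym by blast
  ultimately have "load_edge V E P (comp_of a) Q q p i"
    using a' Q unfolding emits_def by unfold_locales auto
  then show ?thesis
    using that q by blast
qed

end

section \<open>Interior vertices of a long open path\<close>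

locale big_path = optimal +
  fixes Q assumes Q: "Q \<in># P" and nc: "\<not> cyc Q" and len4: "4 \<le> length Q"
begin

definition last_ix :: nat where "last_ix = length Q - 1"

lemma len: "length Q = Suc last_ix" and last_ix_ge3: "3 \<le> last_ix"
  using len4 by (simp_all add: last_ix_def)

lemma ori_len: "ori Q q \<Longrightarrow> length q = Suc last_ix"
  using ori_facts(4)[OF _ Q] len by simp

lemma ori_last: "ori Q q \<Longrightarrow> last q = q ! last_ix"
  using ori_facts(9)[OF _ Q] ori_len by (simp add: last_conv_nth)

lemma ori_inj: "ori Q q \<Longrightarrow> i \<le> last_ix \<Longrightarrow> j \<le> last_ix \<Longrightarrow> q ! i = q ! j \<longleftrightarrow> i = j"
  using ori_facts(5)[OF _ Q] ori_len by (auto simp: nth_eq_iff_index_eq)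

lemma ori_set: "ori Q q \<Longrightarrow> i \<le> last_ix \<Longrightarrow> q ! i \<in> set Q"
  using ori_facts(3)[OF _ Q, of q] ori_len[of q] nth_mem[of i q] by auto

lemma ori_rev_nth: "ori Q q \<Longrightarrow> i \<le> last_ix \<Longrightarrow> rev q ! i = q ! (last_ix - i)"
  using ori_len[of q] by (simp add: rev_nth)

lemma ori_rev: "ori Q q \<Longrightarrow> ori Q (rev q)"
  using ori_facts(8)[OF _ Q] by blast

text \<open>The bounds on \<open>i\<close> discard the path edges at positions 1 and
  \<open>last_ix - 1\<close>.\<close>

definition chord_count :: "'a list \<Rightarrow> nat \<Rightarrow> nat" where
  "chord_count q i = of_bool (2 \<le> i \<and> E (q ! 0) (q ! i)) + of_bool (i + 2 \<le> last_ix \<and> E (q ! last_ix) (q ! i))"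

abbreviation hit_count :: "'a \<Rightarrow> nat" where "hit_count v \<equiv> card (hits Q v)"

abbreviation load_count :: "'a \<Rightarrow> nat" where "load_count v \<equiv> card (loads v)"

lemma chord_count_le: "chord_count q i \<le> 2" "chord_count q 1 \<le> 1"
  by (auto simp: chord_count_def)

lemma inflow_interior:
  assumes "ori Q q" "0 < i" "i < last_ix"
  shows "inflow (q ! i) = hit_weight Q (q ! i) + load_count (q ! i) / 4"
  using inflow_eq[OF Q ori_set] ori_U[OF Q assms(1) nc, of i] assms ori_len by auto

text \<open>Of the six edges at an interior vertex, two belong to the path.\<close>

lemma degree_budget:
  assumes q: "ori Q q" and i: "0 < i" "i < last_ix"
  shows "hit_count (q ! i) + chord_count q i + load_count (q ! i) \<le> 4"
    and "0 < j \<Longrightarrow> j < last_ix \<Longrightarrow> j \<noteq> i - 1 \<Longrightarrow> j \<noteq> Suc i \<Longrightarrow> E (q ! i) (q ! j) \<Longrightarrow> hit_count (q ! i) + chord_count q i + load_count (q ! i) \<le> 3"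
proof -
  let ?v = "q ! i"
  have v: "?v \<in> set Q"
    using ori_set q i by auto
  then have cv: "comp_of ?v = Q" and vV: "?v \<in> V"
    using comp_of_eq Q ppart_subset[OF pp Q] by blast+
  have "hits Q ?v \<union> loads ?v \<subseteq> {u \<in> nbs ?v. comp_of u \<noteq> Q}"
    using hits_iff loads_iff[OF vV] cv by auto
  then have "card (hits Q ?v \<union> loads ?v) \<le> card {u \<in> nbs ?v. comp_of u \<noteq> Q}"
    by (intro card_mono finite_subset[OF _ fin_nbs[of ?v]]) auto
  moreover have "hits Q ?v \<inter> loads ?v = {}"
    using hits_iff loads_iff[OF vV] by auto
  ultimately have outflow: "hit_count ?v + load_count ?v + card {u \<in> set Q. E ?v u} \<le> 6"
    using own_nbs[OF Q v] by (simp add: card_Un_disjoint)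
  have own: "card I \<le> card {u \<in> set Q. E ?v u}" if "I \<subseteq> {k. k \<le> last_ix \<and> E ?v (q ! k)}" for I
  proof -
    have "card I = card ((!) q ` I)"
      using that ori_inj[OF q] by (intro card_image[symmetric] inj_onI) auto
    also have "\<dots> \<le> card {u \<in> set Q. E ?v u}"
      using that ori_set[OF q] by (intro card_mono) auto
    finally show ?thesis .
  qed
  have path: "E ?v (q ! (i - 1))" "E ?v (q ! Suc i)"
    using pth_nth[OF ori_facts(1)[OF q Q], of "i - 1"] pth_nth[OF ori_facts(1)[OF q Q], of i] i ori_len[OF q] E_sym
    by auto
  let ?C = "(if 2 \<le> i \<and> E (q ! 0) ?v then {0} else {}) \<union> (if i + 2 \<le> last_ix \<and> E (q ! last_ix) ?v then {last_ix} else {})"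
  have C: "card ?C = chord_count q i" "?C \<inter> {i - 1, Suc i} = {}"
    using i unfolding chord_count_def by auto
  have "card (?C \<union> {i - 1, Suc i}) = chord_count q i + 2"
    using C by (subst card_Un_disjoint) auto
  moreover have "?C \<union> {i - 1, Suc i} \<subseteq> {k. k \<le> last_ix \<and> E ?v (q ! k)}"
    using path i E_sym by auto
  ultimately show "hit_count ?v + chord_count q i + load_count ?v \<le> 4"
    using own[of "?C \<union> {i - 1, Suc i}"] outflow by simp
  assume j: "0 < j" "j < last_ix" "j \<noteq> i - 1" "j \<noteq> Suc i" "E ?v (q ! j)"
  have "j \<notin> ?C \<union> {i - 1, Suc i}"
    using j by auto
  then have "card (insert j (?C \<union> {i - 1, Suc i})) = chord_count q i + 3"
    using \<open>card (?C \<union> {i - 1, Suc i}) = chord_count q i + 2\<close> by (subst card_insert_disjoint) auto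
  moreover have "insert j (?C \<union> {i - 1, Suc i}) \<subseteq> {k. k \<le> last_ix \<and> E ?v (q ! k)}"
    using path i j E_sym by auto
  ultimately show "hit_count ?v + chord_count q i + load_count ?v \<le> 3"
    using own[of "insert j (?C \<union> {i - 1, Suc i})"] outflow by simp
qed

lemma inflow_le: "ori Q q \<Longrightarrow> 0 < i \<Longrightarrow> i < last_ix \<Longrightarrow> inflow (q ! i) \<le> hit_count (q ! i) / 2 + load_count (q ! i) / 4"
  using inflow_interior hit_weight_le[of Q "q ! i"] by auto

lemma inflow_pos_cases:
  assumes "ori Q q" "0 < i" "i < last_ix" "0 < inflow (q ! i)"
  shows "hits Q (q ! i) \<noteq> {} \<or> loads (q ! i) \<noteq> {}"
  using inflow_interior[OF assms(1-3)] assms(4) by (auto simp: hit_weight_def)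

text \<open>Such a chord would by rotation turn position \<open>i\<close> into an end, which is
  compatible neither with a hit nor with a load edge there.\<close>

lemma inflow_pos_chord:
  assumes q: "ori Q q" and i: "0 < i" "i < last_ix" and pos: "0 < inflow (q ! i)"
  shows "\<not> E (q ! 0) (q ! Suc i)" "\<not> E (q ! last_ix) (q ! (i - 1))"
proof -
  have 1: "\<not> E (q ! 0) (q ! Suc i)" if tt: "ori Q q" "0 < i" "i < last_ix" "0 < inflow (q ! i)" for q i
    using inflow_pos_cases[OF tt]
  proof
    assume "hits Q (q ! i) \<noteq> {}"
    then show ?thesis
      using hit_chord[OF Q tt(1), of i] tt ori_len by auto
  next
    assume "loads (q ! i) \<noteq> {}"
    then obtain a where a: "a \<in> loads (q ! i)"
      by blast
    obtain r where "load_edge V E P (comp_of a) Q r q i"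
      using load_edgeI[OF Q nc tt(1,2) _ a] tt ori_len by auto
    then show ?thesis
      by (rule load_edge.load_chord)
  qed
  show "\<not> E (q ! 0) (q ! Suc i)"
    using 1 assms by blast
  have "rev q ! (last_ix - i) = q ! i" "rev q ! 0 = q ! last_ix" "rev q ! Suc (last_ix - i) = q ! (i - 1)"
    using ori_rev_nth[OF q] i by (auto simp: Suc_diff_le)
  then show "\<not> E (q ! last_ix) (q ! (i - 1))"
    using 1[OF ori_rev[OF q], of "last_ix - i"] i pos by auto
qed

lemma load_nbrs:
  assumes q: "ori Q q" and i: "0 < i" "i < last_ix" and a: "loads (q ! i) \<noteq> {}"
  shows "hits Q (q ! Suc i) = {}" "hits Q (q ! (i - 1)) = {}"
    "even last_ix \<Longrightarrow> odd i" "odd last_ix \<Longrightarrow> i = 1 \<or> Suc i = last_ix"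
proof -
  have 1: "hits Q (q ! Suc i) = {}" "even last_ix \<Longrightarrow> odd i" "odd last_ix \<Longrightarrow> i = 1 \<or> Suc i = last_ix"
    if q: "ori Q q" and i: "0 < i" "i < last_ix" and a: "loads (q ! i) \<noteq> {}" for q i
  proof -
    obtain a where a: "a \<in> loads (q ! i)"
      using a by blast
    obtain r where r: "load_edge V E P (comp_of a) Q r q i"
      using load_edgeI[OF Q nc q(1) i(1) _ a] i ori_len[OF q] by auto
    show "hits Q (q ! Suc i) = {}" "even last_ix \<Longrightarrow> odd i" "odd last_ix \<Longrightarrow> i = 1 \<or> Suc i = last_ix"
      using load_edge.load_next[OF r] load_edge.load_position[OF r] ori_len[OF q] by auto
  qed
  show "hits Q (q ! Suc i) = {}" "even last_ix \<Longrightarrow> odd i" "odd last_ix \<Longrightarrow> i = 1 \<or> Suc i = last_ix"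
    using 1 assms by blast+
  have "rev q ! (last_ix - i) = q ! i" "rev q ! Suc (last_ix - i) = q ! (i - 1)"
    using ori_rev_nth[OF q] i by (auto simp: Suc_diff_le)
  then show "hits Q (q ! (i - 1)) = {}"
    using 1(1)[OF ori_rev[OF q], of "last_ix - i"] i a by auto
qed

lemma hits_adjacent:
  assumes q: "ori Q q" and i: "Suc i \<le> last_ix" and h: "hits Q (q ! i) \<noteq> {}" "hits Q (q ! Suc i) \<noteq> {}"
  shows "hit_weight Q (q ! i) + hit_weight Q (q ! Suc i) \<le> 1"
proof -
  note o = ori_facts[OF q Q]
  have "pth (take (Suc i) q)" "pth (drop (Suc i) q)"
    using pth_take pth_drop o i ori_len[OF q] by auto
  moreover have "mset (take (Suc i) q) + mset (drop (Suc i) q) = mset Q"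
    using mset_take_drop o by metis
  moreover have "last (take (Suc i) q) = q ! i" "hd (drop (Suc i) q) = q ! Suc i"
    using last_take_Suc[of i q] i ori_len[OF q] by (auto simp: hd_drop_conv_nth)
  ultimately show ?thesis
    using hits_pair[OF Q _ _ _ _ _ h] by auto
qed

text \<open>The edge from \<open>q ! 0\<close> to \<open>q ! j\<close> closes a cycle that can be opened next to \<open>q ! 1\<close>.\<close>

lemma hits_cycle:
  assumes q: "ori Q q" and j: "2 \<le> j" "Suc j \<le> last_ix" "E (q ! 0) (q ! j)"
    and h: "hits Q (q ! 1) \<noteq> {}" "hits Q (q ! Suc j) \<noteq> {}"
  shows "hit_weight Q (q ! 1) + hit_weight Q (q ! Suc j) \<le> 1"
proof -
  note o = ori_facts[OF q Q]
  obtain x t where xt: "q = x # t"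
    using o(9) by (cases q) auto
  let ?c = "take j t @ [x]"
  have l: "j < length t"
    using xt j ori_len[OF q] by simp
  have "pth t"
    using pth_drop[OF o(1), of 1] xt l by (cases t) auto
  then have "pth (take j t)"
    using pth_take j by auto
  moreover have "last (take j t) = q ! j"
    using last_take_Suc[of "j - 1" t] j l xt by (cases j) auto
  ultimately have "pth ?c"
    using j(3) xt E_sym by (intro pth_append) auto
  moreover have "hd ?c = q ! 1"
    using xt l j by (cases t; cases j) auto
  moreover have "pth (drop (Suc j) q)" "hd (drop (Suc j) q) = q ! Suc j"
    using pth_drop[OF o(1), of "Suc j"] j ori_len[OF q] by (auto simp: hd_drop_conv_nth)
  moreover have "mset ?c + mset (drop (Suc j) q) = mset Q"
    using mset_take_drop[of "Suc j" q] o(2) xt by simp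
  ultimately show ?thesis
    using hits_pair[OF Q _ _ _ _ _ h] by auto
qed

text \<open>Reversing the segment from position 2 to \<open>j\<close> and continuing along the chord
  exposes \<open>q ! j\<close>, while the first two vertices form a path ending in
  \<open>q ! 1\<close>.\<close>

lemma hits_inner_chord:
  assumes q: "ori Q q" and j: "3 \<le> j" "Suc j \<le> last_ix" "E (q ! 2) (q ! Suc j)"
    and h: "hits Q (q ! 1) \<noteq> {}" "hits Q (q ! j) \<noteq> {}"
  shows "hit_weight Q (q ! 1) + hit_weight Q (q ! j) \<le> 1"
proof -
  note o = ori_facts[OF q Q]
  let ?b = "drop 2 (take (Suc j) q)" and ?c = "drop (Suc j) q"
  have l: "Suc j < length q"
    using j ori_len[OF q] by simp
  have a: "pth (take 2 q)" "last (take 2 q) = q ! 1"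
    using pth_take[OF o(1), of 2] last_take_Suc[of 1 q] l j by (auto simp: numeral_2_eq_2)
  have b: "pth ?b" "hd ?b = q ! 2" "last ?b = q ! j"
    using pth_drop[of "take (Suc j) q" 2] pth_take[OF o(1), of "Suc j"] l j last_take_Suc[of j q]
    by (auto simp: hd_drop_conv_nth)
  have c: "pth ?c" "hd ?c = q ! Suc j"
    using pth_drop[OF o(1), of "Suc j"] l by (auto simp: hd_drop_conv_nth)
  have "pth (rev ?b @ ?c)"
    using b c j(3) by (intro pth_append) (auto simp: last_rev)
  moreover have "hd (rev ?b @ ?c) = q ! j"
    using b l j by (auto simp: hd_append hd_rev)
  moreover have "mset (take 2 q) + mset (rev ?b @ ?c) = mset Q"
  proof -
    have "take 2 (take (Suc j) q) = take 2 q"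
      using j by (simp add: min_def)
    then have "mset (take 2 q) + mset ?b = mset (take (Suc j) q)"
      using mset_take_drop[of 2 "take (Suc j) q"] by simp
    then show ?thesis
      using mset_take_drop[of "Suc j" q] o(2) by (simp add: ac_simps)
  qed
  ultimately show ?thesis
    using hits_pair[OF Q a(1) _ _ _ _ h] a by auto
qed

text \<open>An interior vertex has four edges off the path. A hit or a chord is worth at most 1/2
  and a load 1/4, so the total is at most 2, and \<open>2 - saturation\<close> is the slack on which
  the later estimates draw.\<close>

definition saturation :: "'a list \<Rightarrow> nat \<Rightarrow> real" where
  "saturation q i = inflow (q ! i) + chord_count q i / 2"

lemma saturation_rev:
  assumes "ori Q q" "i \<le> last_ix"
  shows "saturation (rev q) (last_ix - i) = saturation q i"
proof -
  have "rev q ! (last_ix - i) = q ! i" "rev q ! 0 = q ! last_ix" "rev q ! last_ix = q ! 0"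
    using ori_rev_nth[OF assms(1)] assms(2) by auto
  moreover have "2 \<le> last_ix - i \<longleftrightarrow> i + 2 \<le> last_ix" "last_ix - i + 2 \<le> last_ix \<longleftrightarrow> 2 \<le> i"
    using assms(2) last_ix_ge3 by auto
  ultimately show ?thesis
    unfolding saturation_def chord_count_def by simp
qed

lemma saturation_le:
  assumes "ori Q q" "0 < i" "i < last_ix"
  shows "saturation q i \<le> real (hit_count (q ! i)) / 2 + real (chord_count q i) / 2 + real (load_count (q ! i)) / 4" "saturation q i \<le> 2"
proof -
  show 1: "saturation q i \<le> real (hit_count (q ! i)) / 2 + real (chord_count q i) / 2 + real (load_count (q ! i)) / 4"
    using inflow_le[OF assms] unfolding saturation_def by simp
  have "real (hit_count (q ! i) + chord_count q i + load_count (q ! i)) \<le> 4"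
    using degree_budget(1)[OF assms] by (metis of_nat_le_iff of_nat_numeral)
  then show "saturation q i \<le> 2"
    using 1 of_nat_0_le_iff[of "load_count (q ! i)", where 'a = real] unfolding of_nat_add by linarith
qed

text \<open>With at most one hitter, the best is one hit, one chord and two loads. With more, all
  hitters lie on one even cycle, which has at least four vertices and hence rate at most
  1/4.\<close>

lemma saturation_rich:
  assumes q: "ori Q q" and nr: "\<not> rich Q (q ! 1)"
  shows "saturation q 1 \<le> 3 / 2"
proof -
  have m: "0 < (1::nat)" "1 < last_ix"
    using last_ix_ge3 by auto
  have b: "real (hit_count (q ! 1)) + real (chord_count q 1) + real (load_count (q ! 1)) \<le> 4" "real (chord_count q 1) \<le> 1"
    using degree_budget(1)[OF q m] chord_count_le(2)[of q] by linarith+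
  show ?thesis
  proof (cases "hit_count (q ! 1) \<le> 1")
    case True
    then show ?thesis
      using saturation_le(1)[OF q m] b of_nat_mono[OF True, where 'a = real] by linarith
  next
    case False
    then have "\<exists>x y. x \<noteq> y \<and> x \<in> hits Q (q ! 1) \<and> y \<in> hits Q (q ! 1)"
      by (metis One_nat_def card_le_Suc0_iff_eq fin_hits)
    then obtain C where C: "C \<in># P" "even (length C)" "cyc C" "hits Q (q ! 1) \<subseteq> set C"
      using nr unfolding rich_def by blast
    have "4 \<le> length C"
      using C(2,3) by (auto simp: cyc_def elim!: evenE)
    then have "hit_rate C \<le> 1 / 4"
      using C(3) frac_le[of 1 1 4 "real (length C)"] by (simp add: hit_rate_def)
    moreover have "comp_of x = C" if "x \<in> hits Q (q ! 1)" for x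
      using that C comp_of_eq by blast
    ultimately have "hit_weight Q (q ! 1) \<le> hit_count (q ! 1) / 4"
      unfolding hit_weight_def using sum_bounded_above[of "hits Q (q ! 1)" "\<lambda>x. hit_rate (comp_of x)" "1/4"] by simp
    then show ?thesis
      using b inflow_interior[OF q m] unfolding saturation_def by simp
  qed
qed

text \<open>The third vertex collects 1/4 along each of its six edges except those to its two path
  neighbours and to \<open>O'\<close>. The latter are made up for by slack: an edge to position
  \<open>2 * a + 1\<close> or \<open>2 * a + 2\<close> forces slack 1/2 at \<open>2 * a + 1\<close>,
  and each such pair receives at most two edges.\<close>

lemma emission:
  assumes q: "ori Q q" and ev: "even last_ix" and rich: "rich Q (q ! 1)"
    and odd: "\<And>i. odd i \<Longrightarrow> i < last_ix \<Longrightarrow> 0 < inflow (q ! i)" and even: "\<And>i. even i \<Longrightarrow> i < last_ix \<Longrightarrow> inflow (q ! i) = 0"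
    and D: "(\<Sum>a<last_ix div 2. 2 - saturation q (2 * a + 1)) < 1"
  shows "1 - (\<Sum>a<last_ix div 2. 2 - saturation q (2 * a + 1)) \<le> outflow (q ! 2)"
proof -
  have m4: "4 \<le> last_ix"
    using ev last_ix_ge3 by presburger
  let ?v = "q ! 2" and ?D = "\<Sum>a<last_ix div 2. 2 - saturation q (2 * a + 1)"
  have v: "?v \<in> set Q" "?v \<notin> ends Q" "comp_of ?v = Q"
    using ori_set[OF q, of 2] ori_U[OF Q q nc, of 2] ori_len[OF q] m4 comp_of_eq[OF Q] by auto
  have em: "emits Q ?v"
    unfolding emits_def using q rich nc len ev m4 by auto
  have hv: "hits Q ?v = {}"
  proof (rule ccontr)
    assume "hits Q ?v \<noteq> {}"
    then have "0 < inflow ?v"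
      using inflow_interior[OF q, of 2] hit_weight_pos m4 by fastforce
    then show False
      using even[of 2] m4 by simp
  qed
  \<comment> \<open>A neighbour in another component cannot be an end there, since it would hit
    \<open>q ! 2\<close>; hence every edge leaving the path collects.\<close>
  have "1 / 4 \<le> charge ?v u" if "u \<in> nbs ?v" "comp_of u \<noteq> Q" for u
    using that hv v em hits_iff[of u Q ?v] unfolding charge_def by auto
  from outflow_ge[OF Q v(1) this] have o1: "(6 - real (card {u \<in> set Q. E ?v u})) / 4 \<le> outflow ?v"
    by simp
  define O' where "O' = {j. 3 < j \<and> j < last_ix \<and> E ?v (q ! j)}"
  define B where "B = {a. a < last_ix div 2 \<and> 1 \<le> a \<and> (2 * a + 1 \<in> O' \<or> 2 * a + 2 \<in> O')}"
  have fin: "finite O'" "finite B"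
    unfolding O'_def B_def by auto
  have n0: "\<not> E (q ! 0) (q ! 2)" "\<not> E (q ! last_ix) (q ! 2)"
  proof -
    have "0 < inflow (q ! 1)" "0 < inflow (q ! 3)"
      using odd m4 by auto
    then show "\<not> E (q ! 0) (q ! 2)" "\<not> E (q ! last_ix) (q ! 2)"
      using inflow_pos_chord(1)[OF q, of 1] inflow_pos_chord(2)[OF q, of 3] m4
      by (simp_all add: numeral_2_eq_2)
  qed
  have "{u \<in> set Q. E ?v u} \<subseteq> (!) q ` ({1, 3} \<union> O')"
  proof
    fix u assume "u \<in> {u \<in> set Q. E ?v u}"
    then have "u \<in> set q" "E ?v u"
      using ori_facts(3)[OF q Q] by auto
    then obtain j where j: "j \<le> last_ix" "u = q ! j" "E ?v (q ! j)"
      using in_set_conv_nth[of u q] ori_len[OF q] by (auto simp: less_Suc_eq_le)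
    then have "j \<noteq> 0" "j \<noteq> last_ix" "j \<noteq> 2"
      using n0 E_sym E_irr by metis+
    then have "j \<in> {1, 3} \<union> O'"
      using j unfolding O'_def by auto
    then show "u \<in> (!) q ` ({1, 3} \<union> O')"
      using j by blast
  qed
  then have "card {u \<in> set Q. E ?v u} \<le> card ((!) q ` ({1, 3} \<union> O'))"
    using fin by (intro card_mono) auto
  also have "\<dots> \<le> card ({1, 3} \<union> O')"
    using fin by (intro card_image_le) auto
  also have "\<dots> \<le> card {1, 3 :: nat} + card O'"
    by (rule card_Un_le)
  finally have c1: "card {u \<in> set Q. E ?v u} \<le> 2 + card O'"
    by simp
  have "O' \<subseteq> (\<lambda>a. 2 * a + 1) ` B \<union> (\<lambda>a. 2 * a + 2) ` B"
  proof
    fix j assume j: "j \<in> O'"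
    define a where "a = (j - 1) div 2"
    have "j = 2 * a + 1 \<or> j = 2 * a + 2" "1 \<le> a" "a < last_ix div 2"
      using j ev unfolding O'_def a_def by (auto elim!: evenE)
    then show "j \<in> (\<lambda>a. 2 * a + 1) ` B \<union> (\<lambda>a. 2 * a + 2) ` B"
      using j unfolding B_def by auto
  qed
  then have "card O' \<le> card ((\<lambda>a. 2 * a + 1) ` B \<union> (\<lambda>a. 2 * a + 2) ` B)"
    using fin by (intro card_mono) auto
  also have "\<dots> \<le> card ((\<lambda>a. 2 * a + 1) ` B) + card ((\<lambda>a. 2 * a + 2) ` B)"
    by (rule card_Un_le)
  also have "\<dots> \<le> card B + card B"
    using fin by (intro add_mono card_image_le)
  finally have c2: "card O' \<le> 2 * card B"
    by simp
  have nn: "0 \<le> 2 - saturation q (2 * a + 1)" if "a < last_ix div 2" for a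
    using saturation_le(2)[OF q, of "2 * a + 1"] that ev by auto
  have half: "1 / 2 \<le> 2 - saturation q (2 * a + 1)" if "a \<in> B" for a
  proof -
    let ?o = "2 * a + 1"
    have a: "a < last_ix div 2" "1 \<le> a" "?o \<in> O' \<or> Suc ?o \<in> O'"
      using that unfolding B_def by auto
    have o: "0 < ?o" "?o < last_ix" "3 \<le> ?o"
      using a ev by (auto elim!: evenE)
    have b: "real (hit_count (q ! ?o)) + real (chord_count q ?o) + real (load_count (q ! ?o)) \<le> 4" "real (chord_count q ?o) \<le> 2"
      using degree_budget(1)[OF q o(1,2)] chord_count_le(1)[of q ?o] by linarith+
    show ?thesis
    proof (cases "?o \<in> O'")
      case True
      then have "E (q ! ?o) (q ! 2)" "3 < ?o"
        using E_sym unfolding O'_def by auto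
      then have "hit_count (q ! ?o) + chord_count q ?o + load_count (q ! ?o) \<le> 3"
        using degree_budget(2)[OF q o(1,2), of 2] m4 by auto
      then have "real (hit_count (q ! ?o)) + real (chord_count q ?o) + real (load_count (q ! ?o)) \<le> 3"
        by linarith
      then show ?thesis
        using saturation_le(1)[OF q o(1,2)] of_nat_0_le_iff[of "load_count (q ! ?o)", where 'a = real] by linarith
    next
      case False
      then have e: "E (q ! 2) (q ! Suc ?o)" "Suc ?o \<le> last_ix"
        using a unfolding O'_def by auto
      \<comment> \<open>Otherwise the inner chord bounds the hit weights at \<open>q ! 1\<close> and
        \<open>q ! ?o\<close> by 1 together. With two hitters at \<open>q ! 1\<close> this leaves
        slack at least 1 at these positions, more than \<open>D\<close> allows.\<close>
      have "hits Q (q ! ?o) = {}"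
      proof (rule ccontr)
        assume ho: "hits Q (q ! ?o) \<noteq> {}"
        have h1: "hits Q (q ! 1) \<noteq> {}" "2 \<le> hit_count (q ! 1)"
        proof -
          obtain x y where xy: "x \<noteq> y" "x \<in> hits Q (q ! 1)" "y \<in> hits Q (q ! 1)"
            using rich unfolding rich_def by blast
          then show "hits Q (q ! 1) \<noteq> {}"
            by blast
          have "card {x, y} \<le> hit_count (q ! 1)"
            using xy by (intro card_mono) auto
          then show "2 \<le> hit_count (q ! 1)"
            using xy by simp
        qed
        have "1 \<le> hit_count (q ! ?o)"
          using ho by (simp add: Suc_le_eq card_gt_0_iff)
        then have r: "2 \<le> real (hit_count (q ! 1))" "1 \<le> real (hit_count (q ! ?o))"
          using h1(2) by linarith+
        have m1: "0 < (1::nat)" "1 < last_ix"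
          using m4 by auto
        have b1: "real (hit_count (q ! 1)) + real (chord_count q 1) + real (load_count (q ! 1)) \<le> 4" "real (chord_count q 1) \<le> 1"
          using degree_budget(1)[OF q m1] chord_count_le(2)[of q] by linarith+
        have "hit_weight Q (q ! 1) + hit_weight Q (q ! ?o) \<le> 1"
          by (rule hits_inner_chord[OF q o(3) e(2,1) h1(1) ho])
        then have "saturation q 1 + saturation q ?o \<le> 3"
          using b b1 r inflow_interior[OF q m1] inflow_interior[OF q o(1,2)] unfolding saturation_def by simp
        moreover have "(\<Sum>a\<in>{0, a}. 2 - saturation q (2 * a + 1)) \<le> ?D"
          using a m4 nn by (intro sum_mono2) auto
        ultimately show False
          using D a(2) by simp
      qed
      \<comment> \<open>Without hits the best is two chords and two loads, worth 3/2.\<close>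
      then show ?thesis
        using inflow_interior[OF q o(1,2)] b unfolding saturation_def by (simp add: hit_weight_def)
    qed
  qed
  have "real (card B) / 2 \<le> (\<Sum>a\<in>B. 2 - saturation q (2 * a + 1))"
    using sum_bounded_below[of B "1/2" "\<lambda>a. 2 - saturation q (2 * a + 1)"] half by simp
  also have "\<dots> \<le> ?D"
    using nn by (intro sum_mono2) (auto simp: B_def)
  finally have "real (card O') \<le> 4 * ?D"
    using c2 by linarith
  moreover have "real (card {u \<in> set Q. E ?v u}) \<le> 2 + real (card O')"
    using c1 by linarith
  ultimately show ?thesis
    using o1 unfolding diff_divide_distrib by linarith
qed

end

section \<open>Long paths\<close>

context big_path
begin

text \<open>Indexing by slots makes a chord from the first vertex and one from the last share a slot
  exactly in the configuration that \<open>no_crossing\<close> forbids.\<close>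

definition left_chords :: "nat set" where
  "left_chords = {j. 0 < j \<and> Suc j < last_ix \<and> E (Q ! 0) (Q ! Suc j)}"

definition right_chords :: "nat set" where
  "right_chords = {j. 0 < j \<and> Suc j < last_ix \<and> E (Q ! last_ix) (Q ! j)}"

definition inflow_at :: "nat \<Rightarrow> real" where
  "inflow_at i = (if 0 < i \<and> i < last_ix then inflow (Q ! i) else 0)"

definition slot :: "nat \<Rightarrow> real" where
  "slot j = of_bool (j \<in> left_chords \<union> right_chords)"

lemma chords_disjoint: "left_chords \<inter> right_chords = {}" "left_chords \<subseteq> {..<last_ix}" "right_chords \<subseteq> {..<last_ix}"
proof -
  have "False" if "j \<in> left_chords" "j \<in> right_chords" for j
    using no_crossing[OF Q ori_refl(1) nc, of j] ori_last[OF ori_refl(1)] len4 len that unfolding left_chords_def right_chords_def by auto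
  then show "left_chords \<inter> right_chords = {}"
    by blast
qed (auto simp: left_chords_def right_chords_def)

lemma sum_slot: "(\<Sum>j<last_ix. slot j) = card left_chords + card right_chords"
proof -
  have "(\<Sum>j<last_ix. slot j) = card (left_chords \<union> right_chords)"
  proof -
    have "(\<Sum>j<last_ix. slot j) = (\<Sum>j\<in>left_chords \<union> right_chords. 1)"
      using chords_disjoint by (intro sum.mono_neutral_cong_right) (auto simp: slot_def)
    then show ?thesis
      by simp
  qed
  also have "\<dots> = card left_chords + card right_chords"
    using chords_disjoint finite_subset[OF chords_disjoint(2)] finite_subset[OF chords_disjoint(3)] by (simp add: card_Un_disjoint)
  finally show ?thesis
    by simp
qed

lemma hd_last: "hd Q = Q ! 0" "last Q = Q ! last_ix"
  using ori_last[OF ori_refl(1)] pthP[OF Q] by (cases Q; auto)+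

lemma ends_not_adjacent: "\<not> E (Q ! last_ix) (Q ! 0)" "\<not> E (Q ! 0) (Q ! last_ix)"
  using nc hd_last len4 E_sym unfolding cyc_def by auto

lemma own_card:
  assumes "{k. k \<le> last_ix \<and> E u (Q ! k)} \<subseteq> I" "finite I"
  shows "card {v \<in> set Q. E u v} \<le> card I"
proof -
  have "{v \<in> set Q. E u v} \<subseteq> (!) Q ` I"
  proof
    fix v assume "v \<in> {v \<in> set Q. E u v}"
    then obtain k where "k \<le> last_ix" "v = Q ! k" "E u (Q ! k)"
      using len by (auto simp: in_set_conv_nth less_Suc_eq_le)
    then show "v \<in> (!) Q ` I"
      using assms(1) by blast
  qed
  then have "card {v \<in> set Q. E u v} \<le> card ((!) Q ` I)"
    using assms(2) by (intro card_mono) auto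
  also have "\<dots> \<le> card I"
    using assms(2) by (rule card_image_le)
  finally show ?thesis .
qed

text \<open>As the path is open, its ends are not adjacent. Inside \<open>Q\<close> an end sees only
  its path neighbour and its chords, and the remaining edges collect 1/2 each.\<close>

lemma outflow_ends: "5 - (\<Sum>j<last_ix. slot j) / 2 \<le> outflow (Q ! 0) + outflow (Q ! last_ix)"
proof -
  have ends: "Q ! 0 \<in> ends Q" "Q ! last_ix \<in> ends Q"
    using hd_last nc by (auto simp: ends_def)
  have fin: "finite left_chords" "finite right_chords"
    using finite_subset[OF chords_disjoint(2)] finite_subset[OF chords_disjoint(3)] by auto
  have "{k. k \<le> last_ix \<and> E (Q ! 0) (Q ! k)} \<subseteq> {1} \<union> Suc ` left_chords"
  proof
    fix k assume k: "k \<in> {k. k \<le> last_ix \<and> E (Q ! 0) (Q ! k)}"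
    then have "k \<noteq> 0" "k \<noteq> last_ix"
      using ends_not_adjacent E_irr[of "Q ! 0"] by (cases k; auto)+
    with k show "k \<in> {1} \<union> Suc ` left_chords"
      unfolding left_chords_def by (cases k) (auto simp: image_iff)
  qed
  then have "card {v \<in> set Q. E (Q ! 0) v} \<le> card ({1} \<union> Suc ` left_chords)"
    using fin by (intro own_card) auto
  also have "\<dots> \<le> card {1 :: nat} + card (Suc ` left_chords)"
    by (rule card_Un_le)
  also have "\<dots> = 1 + card left_chords"
    by (simp add: card_image)
  finally have a: "real (card {v \<in> set Q. E (Q ! 0) v}) \<le> 1 + real (card left_chords)"
    by linarith
  have "{k. k \<le> last_ix \<and> E (Q ! last_ix) (Q ! k)} \<subseteq> {last_ix - 1} \<union> right_chords"
  proof
    fix k assume k: "k \<in> {k. k \<le> last_ix \<and> E (Q ! last_ix) (Q ! k)}"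
    then have "k \<noteq> 0" "k \<noteq> last_ix"
      using ends_not_adjacent E_irr[of "Q ! last_ix"] by (cases k; auto)+
    with k show "k \<in> {last_ix - 1} \<union> right_chords"
      unfolding right_chords_def by auto
  qed
  then have "card {v \<in> set Q. E (Q ! last_ix) v} \<le> card ({last_ix - 1} \<union> right_chords)"
    using fin by (intro own_card) auto
  also have "\<dots> \<le> card {last_ix - 1} + card right_chords"
    by (rule card_Un_le)
  finally have b: "real (card {v \<in> set Q. E (Q ! last_ix) v}) \<le> 1 + real (card right_chords)"
    by simp
  have w: "hit_rate Q = 1 / 2"
    using nc by (simp add: hit_rate_def)
  show ?thesis
    using outflow_end[OF Q ends(1)] outflow_end[OF Q ends(2)] a b unfolding w sum_slot by (simp add: field_simps)
qed

text \<open>The constant \<open>real last_ix - 1\<close> is \<open>length Q - 7\<close> plus the 5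
  collected at the ends before chords are deducted.\<close>

lemma val_ge: "real last_ix - 1 - ((\<Sum>i<last_ix. inflow_at i) + (\<Sum>j<last_ix. slot j) / 2) + (\<Sum>i\<in>{0<..<last_ix}. outflow (Q ! i)) \<le> val Q"
proof -
  have split: "(\<Sum>v\<in>set Q. g v) = g (Q ! 0) + (\<Sum>i\<in>{0<..<last_ix}. g (Q ! i)) + g (Q ! last_ix)" for g :: "'a \<Rightarrow> real"
  proof -
    have "(\<Sum>v\<in>set Q. g v) = sum_list (map g Q)"
      using ppart_distinct[OF pp Q] by (simp add: sum_list_distinct_conv_sum_set)
    also have "\<dots> = (\<Sum>i\<in>{0..<Suc last_ix}. g (Q ! i))"
      using len by (simp add: sum_list_sum_nth)
    also have "{0..<Suc last_ix} = insert 0 (insert last_ix {0<..<last_ix})"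
      by auto
    finally show ?thesis
      using last_ix_ge3 by simp
  qed
  have ends: "inflow (Q ! 0) = 0" "inflow (Q ! last_ix) = 0"
    using inflow_U[OF Q] ori_set[OF ori_refl(1)] hd_last nc by (auto simp: ends_def)
  have "(\<Sum>i<last_ix. inflow_at i) = (\<Sum>i\<in>{0<..<last_ix}. inflow (Q ! i))"
  proof -
    have "{..<last_ix} = insert 0 {0<..<last_ix}"
      using last_ix_ge3 by auto
    then show ?thesis
      by (simp add: inflow_at_def)
  qed
  then show ?thesis
    using split[of outflow] split[of inflow] ends outflow_ends len unfolding val_def by (simp add: sum_subtractf)
qed

text \<open>A loaded position excludes the chords that would occupy its two slots without ending at
  it.\<close>

lemma slot_chord_count:
  assumes "0 < i" "i < last_ix" "0 < inflow (Q ! i)"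
  shows "slot (i - 1) + slot i = chord_count Q i"
proof -
  have "i - 1 \<in> left_chords \<union> right_chords \<longleftrightarrow> 2 \<le> i \<and> E (Q ! 0) (Q ! i)" "i \<in> left_chords \<union> right_chords \<longleftrightarrow> i + 2 \<le> last_ix \<and> E (Q ! last_ix) (Q ! i)"
    using inflow_pos_chord[OF ori_refl(1) assms] assms(1,2) unfolding left_chords_def right_chords_def by auto
  then show ?thesis
    unfolding slot_def chord_count_def by simp
qed

lemma saturation_eq: "0 < i \<Longrightarrow> i < last_ix \<Longrightarrow> 0 < inflow (Q ! i) \<Longrightarrow> inflow_at i + (slot (i - 1) + slot i) / 2 = saturation Q i"
  using slot_chord_count[of i] unfolding saturation_def inflow_at_def by simp

lemma slot_01: "0 \<le> slot j" "slot j \<le> 1" "slot j = 0 \<or> slot j = 1"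
  by (auto simp: slot_def)

text \<open>The one place where two adjacent vertices can both carry load edges. Without hits each
  pays at most four times 1/4, which a path on four vertices can afford.\<close>

lemma double_load:
  assumes "last_ix = 3" "loads (Q ! 1) \<noteq> {}" "loads (Q ! 2) \<noteq> {}"
  shows "(\<Sum>i<last_ix. inflow_at i) + (\<Sum>j<last_ix. slot j) / 2 \<le> 2"
proof -
  have h: "hits Q (Q ! 2) = {}" "hits Q (Q ! 1) = {}"
    using load_nbrs(1)[OF ori_refl(1), of 1] load_nbrs(2)[OF ori_refl(1), of 2] assms
    by (simp_all add: numeral_2_eq_2)
  have i: "inflow (Q ! i) \<le> 1 \<and> 0 < inflow (Q ! i)" if "i = 1 \<or> i = 2" for i
  proof -
    have "0 < i" "i < last_ix"
      using that assms by auto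
    then show ?thesis
      using inflow_interior[OF ori_refl(1), of i] degree_budget(1)[OF ori_refl(1), of i] h that assms(2,3)
      by (auto simp: hit_weight_def card_gt_0_iff)
  qed
  have "1 \<notin> left_chords" "1 \<notin> right_chords"
    using inflow_pos_chord(1)[OF ori_refl(1), of 1] inflow_pos_chord(2)[OF ori_refl(1), of 2] i[of 1] i[of 2] assms(1)
    unfolding left_chords_def right_chords_def by auto
  moreover have "0 \<notin> left_chords \<union> right_chords" "2 \<notin> left_chords \<union> right_chords"
    unfolding left_chords_def right_chords_def using assms(1) by auto
  ultimately have "slot 0 = 0" "slot 1 = 0" "slot 2 = 0"
    unfolding slot_def by auto
  then show ?thesis
    using i[of 1] i[of 2] assms(1) unfolding inflow_at_def by (simp add: eval_nat_numeral)
qed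

text \<open>\<open>big\<close> is the situation in which the bound of \<open>val_ge\<close> is
  negative as long as interior vertices collect nothing.\<close>

lemma slot_loadI:
  assumes big: "real last_ix - 1 < (\<Sum>i<last_ix. inflow_at i) + (\<Sum>j<last_ix. slot j) / 2"
  shows "slot_load inflow_at slot last_ix"
proof
  have nd: "\<not> (last_ix = 3 \<and> loads (Q ! 1) \<noteq> {} \<and> loads (Q ! 2) \<noteq> {})"
  proof
    assume *: "last_ix = 3 \<and> loads (Q ! 1) \<noteq> {} \<and> loads (Q ! 2) \<noteq> {}"
    then have "(\<Sum>i<last_ix. inflow_at i) + (\<Sum>j<last_ix. slot j) / 2 \<le> 2" "real last_ix = 3"
      using double_load by simp_all
    then show False
      using big by linarith
  qed
  show "inflow_at i + (slot (i - 1) + slot i) / 2 \<le> 2" if "0 < i" "i < last_ix" for i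
  proof (cases "0 < inflow (Q ! i)")
    case True
    then show ?thesis
      using saturation_eq[OF that] saturation_le(2)[OF ori_refl(1) that] by simp
  next
    case False
    then have "inflow_at i = 0"
      using inflow_nonneg[of "Q ! i"] unfolding inflow_at_def by auto
    then show ?thesis
      using slot_01[of "i - 1"] slot_01[of i] by simp
  qed
  show "inflow_at i + inflow_at (Suc i) \<le> 1 \<and> slot i = 0" if i: "0 < i" "Suc i < last_ix" "0 < inflow_at i" "0 < inflow_at (Suc i)" for i
  proof -
    have p: "0 < inflow (Q ! i)" "0 < inflow (Q ! Suc i)"
      using i unfolding inflow_at_def by auto
    have "slot i = 0"
      using inflow_pos_chord(1)[OF ori_refl(1) i(1) _ p(1)] inflow_pos_chord(2)[OF ori_refl(1) _ i(2) p(2)] i(2)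
      unfolding slot_def left_chords_def right_chords_def by auto
    have c1: "hits Q (Q ! i) \<noteq> {} \<or> loads (Q ! i) \<noteq> {}" and c2: "hits Q (Q ! Suc i) \<noteq> {} \<or> loads (Q ! Suc i) \<noteq> {}"
      using inflow_pos_cases[OF ori_refl(1)] i p by auto
    \<comment> \<open>By \<open>load_nbrs\<close>, a load edge at one of the two vertices excludes
      hits at the other, which then has load edges as well. Two adjacent positions are not both odd,
      and positions 1 and \<open>last_ix - 1\<close> are adjacent only for
      \<open>last_ix = 3\<close>.\<close>
    have "loads (Q ! i) = {} \<and> loads (Q ! Suc i) = {}"
    proof (rule ccontr)
      assume "\<not> (loads (Q ! i) = {} \<and> loads (Q ! Suc i) = {})"
      then have l: "loads (Q ! i) \<noteq> {}" "loads (Q ! Suc i) \<noteq> {}"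
        using load_nbrs(1)[OF ori_refl(1), of i] load_nbrs(2)[OF ori_refl(1), of "Suc i"] c1 c2 i by auto
      have "odd last_ix"
        using load_nbrs(3)[OF ori_refl(1) _ _ l(1)] load_nbrs(3)[OF ori_refl(1) _ _ l(2)] i by auto
      then have "i = 1" "last_ix = 3"
        using load_nbrs(4)[OF ori_refl(1) _ _ l(1)] load_nbrs(4)[OF ori_refl(1) _ _ l(2)] i by auto
      then show False
        using nd l by (simp add: numeral_2_eq_2)
    qed
    then have "hits Q (Q ! i) \<noteq> {}" "hits Q (Q ! Suc i) \<noteq> {}" "inflow_at i = hit_weight Q (Q ! i)" "inflow_at (Suc i) = hit_weight Q (Q ! Suc i)"
      using c1 c2 i inflow_interior[OF ori_refl(1), of i] inflow_interior[OF ori_refl(1), of "Suc i"] unfolding inflow_at_def by auto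
    then show ?thesis
      using hits_adjacent[OF ori_refl(1), of i] i \<open>slot i = 0\<close> by simp
  qed
qed (use big inflow_nonneg last_ix_ge3 in \<open>auto simp: inflow_at_def slot_def left_chords_def right_chords_def\<close>)

text \<open>Slack below 1/2 admits fewer than two loads in all. With at most three chords, more than
  1 then comes from hits, whereas the chord across the gap closes a cycle and
  \<open>hits_cycle\<close> allows only 1.\<close>

lemma no_gap:
  assumes q: "ori Q q" and b: "2 \<le> b" "b + 2 < last_ix" "E (q ! 0) (q ! (b + 1))"
    and pos: "0 < inflow (q ! 1)" "0 < inflow (q ! (b + 2))"
    and g: "(2 - saturation q 1) + (2 - saturation q (b + 2)) < 1 / 2"
  shows False
proof -
  have i: "0 < (1::nat)" "1 < last_ix" "0 < b + 2"
    using last_ix_ge3 by auto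
  have b1: "real (hit_count (q ! 1)) + real (chord_count q 1) + real (load_count (q ! 1)) \<le> 4" "real (chord_count q 1) \<le> 1"
    using degree_budget(1)[OF q i(1,2)] chord_count_le(2)[of q] by linarith+
  have b2: "real (hit_count (q ! (b + 2))) + real (chord_count q (b + 2)) + real (load_count (q ! (b + 2))) \<le> 4" "real (chord_count q (b + 2)) \<le> 2"
    using degree_budget(1)[OF q i(3) b(2)] chord_count_le(1)[of q "b + 2"] by linarith+
  have e: "saturation q 1 = hit_weight Q (q ! 1) + real (load_count (q ! 1)) / 4 + real (chord_count q 1) / 2"
    "saturation q (b + 2) = hit_weight Q (q ! (b + 2)) + real (load_count (q ! (b + 2))) / 4 + real (chord_count q (b + 2)) / 2"
    using inflow_interior[OF q i(1,2)] inflow_interior[OF q i(3) b(2)] unfolding saturation_def by auto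
  note f = hit_weight_le[of Q "q ! 1"] hit_weight_le[of Q "q ! (b + 2)"]
  have l: "real (load_count (q ! 1)) + real (load_count (q ! (b + 2))) < 2"
    using b1 b2 e f g by linarith
  moreover have "0 \<le> real (load_count (q ! 1))" "0 \<le> real (load_count (q ! (b + 2)))"
    by simp_all
  ultimately have "0 < hit_weight Q (q ! 1)" "0 < hit_weight Q (q ! (b + 2))" "1 < hit_weight Q (q ! 1) + hit_weight Q (q ! (b + 2))"
    using b1 b2 e f g by linarith+
  moreover from this have "hits Q (q ! 1) \<noteq> {}" "hits Q (q ! (b + 2)) \<noteq> {}"
    by (auto simp: hit_weight_def)
  ultimately show False
    using hits_cycle[OF q, of "b + 1"] b by auto
qed

lemma val_big: "0 \<le> val Q"
proof (cases "(\<Sum>i<last_ix. inflow_at i) + (\<Sum>j<last_ix. slot j) / 2 \<le> real last_ix - 1")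
  case True
  then show ?thesis
    using val_ge outflow_nonneg sum_nonneg[of "{0<..<last_ix}" "\<lambda>i. outflow (Q ! i)"] by auto
next
  case False
  then interpret sl: slot_load inflow_at slot last_ix
    using slot_loadI by simp
  have pos: "0 < inflow_at i \<Longrightarrow> 0 < i \<and> i < last_ix \<and> 0 < inflow (Q ! i)" for i
    unfolding inflow_at_def by (auto split: if_splits)
  have G: "sl.G i = saturation Q i" if "0 < inflow_at i" for i
    using pos[OF that] saturation_eq unfolding sl.G_def by auto
  show ?thesis
  proof (rule sl.slot_cases)
    fix b assume b: "2 \<le> b" "b + 2 < last_ix" "slot b = 1" "inflow_at b = 0" "inflow_at (Suc b) = 0"
      "0 < inflow_at 1" "0 < inflow_at (b + 2)" "0 < inflow_at (b - 1)" "0 < inflow_at (last_ix - 1)"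
      "(2 - sl.G 1) + (2 - sl.G (b + 2)) < 1 / 2" "(2 - sl.G (last_ix - 1)) + (2 - sl.G (b - 1)) < 1 / 2"
    have "E (Q ! 0) (Q ! (b + 1)) \<or> E (Q ! last_ix) (Q ! b)"
      using b(3) unfolding slot_def left_chords_def right_chords_def by auto
    then show ?thesis
    proof
      assume "E (Q ! 0) (Q ! (b + 1))"
      then show ?thesis
        using no_gap[OF ori_refl(1) b(1,2)] pos[OF b(6)] pos[OF b(7)] b(10) G[OF b(6)] G[OF b(7)] by auto
    next
      assume e: "E (Q ! last_ix) (Q ! b)"
      define b' where "b' = last_ix - 1 - b"
      have b': "2 \<le> b'" "b' + 2 < last_ix"
        using b unfolding b'_def by auto
      have "rev Q ! 0 = Q ! last_ix" "rev Q ! (b' + 1) = Q ! b" "rev Q ! 1 = Q ! (last_ix - 1)" "rev Q ! (b' + 2) = Q ! (b - 1)"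
      proof -
        have "last_ix - (b' + 1) = b" "last_ix - (b' + 2) = b - 1" "b' + 2 \<le> last_ix"
          using b unfolding b'_def by auto
        then show "rev Q ! 0 = Q ! last_ix" "rev Q ! (b' + 1) = Q ! b" "rev Q ! 1 = Q ! (last_ix - 1)" "rev Q ! (b' + 2) = Q ! (b - 1)"
          using ori_rev_nth[OF ori_refl(1), of 0] ori_rev_nth[OF ori_refl(1), of 1]
            ori_rev_nth[OF ori_refl(1), of "b' + 1"] ori_rev_nth[OF ori_refl(1), of "b' + 2"] by auto
      qed
      moreover have "saturation (rev Q) 1 = saturation Q (last_ix - 1)" "saturation (rev Q) (b' + 2) = saturation Q (b - 1)"
      proof -
        have "last_ix - (last_ix - 1) = 1" "last_ix - (b - 1) = b' + 2"
          using b unfolding b'_def by auto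
        then show "saturation (rev Q) 1 = saturation Q (last_ix - 1)" "saturation (rev Q) (b' + 2) = saturation Q (b - 1)"
          using saturation_rev[OF ori_refl(1), of "last_ix - 1"] saturation_rev[OF ori_refl(1), of "b - 1"] b by auto
      qed
      ultimately show ?thesis
        using no_gap[OF ori_refl(2) b'] e pos[OF b(8)] pos[OF b(9)] b(11) G[OF b(8)] G[OF b(9)] by auto
    qed
  next
    assume "\<And>j. j < last_ix \<Longrightarrow> (0 < inflow_at j) = (\<not> 0 < inflow_at (Suc j))"
    note alt = sl.alternating_sum[OF this]
    obtain k where k: "last_ix = 2 * k" "2 \<le> k"
      using alt(1) last_ix_ge3 by (auto elim!: evenE)
    have odd: "0 < inflow (Q ! i)" if "odd i" "i < last_ix" for i
      using alt(2)[of i] that pos by auto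
    have even: "inflow (Q ! i) = 0" if "even i" "i \<le> last_ix" for i
    proof (cases "0 < i \<and> i < last_ix")
      case True
      then show ?thesis
        using alt(2)[of i] that sl.pos_cases[of i] unfolding inflow_at_def by auto
    next
      case False
      then have "i = 0 \<or> i = last_ix"
        using that by auto
      then show ?thesis
        using inflow_U[OF Q] ori_set[OF ori_refl(1), of i] that(2) hd_last nc by (auto simp: ends_def)
    qed
    let ?D = "\<Sum>a<k. 2 - saturation Q (2 * a + 1)"
    have "?D = (\<Sum>a<k. 2 - sl.G (2 * a + 1))"
    proof (intro sum.cong refl)
      fix a assume "a \<in> {..<k}"
      then have "0 < inflow_at (2 * a + 1)"
        using alt(2)[of "2 * a + 1"] k by auto
      then show "2 - saturation Q (2 * a + 1) = 2 - sl.G (2 * a + 1)"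
        using G by simp
    qed
    then have D: "?D = real last_ix - ((\<Sum>i<last_ix. inflow_at i) + (\<Sum>j<last_ix. slot j) / 2)"
      using alt(3) k by simp
    then have D1: "?D < 1"
      using False by simp
    have rr: "saturation (rev Q) (2 * a + 1) = saturation Q (2 * (k - Suc a) + 1)" if "a < k" for a
    proof -
      have "last_ix - (2 * (k - Suc a) + 1) = 2 * a + 1"
        using that k by auto
      then show ?thesis
        using saturation_rev[OF ori_refl(1), of "2 * (k - Suc a) + 1"] that k by auto
    qed
    have Dr: "(\<Sum>a<k. 2 - saturation (rev Q) (2 * a + 1)) = ?D"
      using sum.nat_diff_reindex[of "\<lambda>a. 2 - saturation Q (2 * a + 1)" k] rr by simp
    \<comment> \<open>If neither second vertex is rich, each has slack at least 1/2, against
      \<open>?D < 1\<close>; the two are distinct because \<open>2 \<le> k\<close>.\<close>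
    have "rich Q (Q ! 1) \<or> rich Q (rev Q ! 1)"
    proof (rule ccontr)
      assume "\<not> ?thesis"
      then have "saturation Q 1 \<le> 3 / 2" "saturation (rev Q) 1 \<le> 3 / 2"
        using saturation_rich[OF ori_refl(1)] saturation_rich[OF ori_refl(2)] by auto
      then have "saturation Q (2 * 0 + 1) \<le> 3 / 2" "saturation Q (2 * (k - 1) + 1) \<le> 3 / 2"
        using rr[of 0] k by auto
      moreover have "(\<Sum>a\<in>{0, k - 1}. 2 - saturation Q (2 * a + 1)) \<le> ?D"
        using k saturation_le(2)[OF ori_refl(1)] by (intro sum_mono2) auto
      ultimately show False
        using D1 k by simp
    qed
    \<comment> \<open>The path lacks exactly \<open>1 - ?D\<close> in \<open>val_ge\<close>, so a
      single emitting vertex is enough.\<close>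
    then have "\<exists>i\<in>{0<..<last_ix}. 1 - ?D \<le> outflow (Q ! i)"
    proof
      assume r: "rich Q (Q ! 1)"
      have "1 - ?D \<le> outflow (Q ! 2)"
        using emission[OF ori_refl(1) alt(1) r odd] even D1 k by simp
      then show ?thesis
        using k by (intro bexI[of _ 2]) auto
    next
      assume r: "rich Q (rev Q ! 1)"
      have rn: "rev Q ! i = Q ! (last_ix - i)" if "i \<le> last_ix" for i
        using ori_rev_nth[OF ori_refl(1) that] .
      have "0 < inflow (rev Q ! i)" if "odd i" "i < last_ix" for i
        using odd[of "last_ix - i"] rn[of i] that alt(1) odd_pos[of i] by auto
      moreover have "inflow (rev Q ! i) = 0" if "even i" "i < last_ix" for i
        using even[of "last_ix - i"] rn[of i] that alt(1) by auto
      ultimately have "1 - ?D \<le> outflow (rev Q ! 2)"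
        using emission[OF ori_refl(2) alt(1) r] Dr D1 k by simp
      then show ?thesis
        using rn[of 2] k by (intro bexI[of _ "last_ix - 2"]) auto
    qed
    then obtain i where i: "i \<in> {0<..<last_ix}" "1 - ?D \<le> outflow (Q ! i)"
      by blast
    have "outflow (Q ! i) \<le> (\<Sum>i\<in>{0<..<last_ix}. outflow (Q ! i))"
      using i(1) outflow_nonneg by (intro member_le_sum) auto
    then show ?thesis
      using val_ge D i(2) by linarith
  qed
qed

end

section \<open>Summing the charges\<close>

context optimal
begin

lemma val_nonneg:
  assumes "Q \<in># P"
  shows "0 \<le> val Q"
proof -
  consider "cyc Q" | "\<not> cyc Q" "length Q = 2" | "\<not> cyc Q" "4 \<le> length Q"
    using lengths[OF assms] by blast
  then show ?thesis
  proof cases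
    case 3
    then interpret big_path V E P Q
      using assms by unfold_locales
    show ?thesis
      by (rule val_big)
  qed (use assms val_cyc val_two in auto)
qed

lemma size_bound: "7 * size P \<le> card V"
proof -
  let ?g = "\<lambda>v. 1 + (outflow v - inflow v)"
  have eq: "sum_list (map ?g p) = val p + 7" if "p \<in># P" for p
  proof -
    have "sum_list (map ?g p) = (\<Sum>v\<in>set p. ?g v)"
      using ppart_distinct[OF pp that] by (simp add: sum_list_distinct_conv_sum_set)
    also have "\<dots> = real (card (set p)) + (\<Sum>v\<in>set p. outflow v - inflow v)"
      by (simp add: sum.distrib)
    finally show ?thesis
      using distinct_card[OF ppart_distinct[OF pp that]] unfolding val_def by simp
  qed
  have "real (card V) = sum ?g V"
    using flow_zero by (simp add: sum.distrib)
  also have "\<dots> = \<Sum>\<^sub># (image_mset (\<lambda>p. sum_list (map ?g p)) P)"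
    using sum_ppart[OF pp, of ?g] by simp
  also have "\<dots> = \<Sum>\<^sub># (image_mset (\<lambda>p. val p + 7) P)"
    using eq by (intro arg_cong[of _ _ sum_mset] image_mset_cong) auto
  also have "\<dots> \<ge> \<Sum>\<^sub># (image_mset (\<lambda>p. 7) P)"
    using val_nonneg by (intro sum_mset_mono) auto
  finally have "7 * real (size P) \<le> real (card V)"
    by (simp add: mult.commute)
  then show ?thesis
    by linarith
qed

lemma path_partition_of: "path_partition V E (set_mset P)"
  unfolding path_partition_def
proof (intro conjI ballI impI)
  fix p assume p: "p \<in># P"
  show "is_path V E p"
    using pthP[OF p] ppart_distinct[OF pp p] ppart_subset[OF pp p]
    unfolding is_path_def pth_def by (auto simp: successively_conv_nth)
next
  fix p q assume "p \<in># P" "q \<in># P" "p \<noteq> q"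
  then show "set p \<inter> set q = {}"
    using ppart_disjoint[OF pp] by blast
next
  show "(\<Union>p\<in>set_mset P. set p) = V"
    using ppart_subset[OF pp] comp_of_in by blast
qed

lemma path_partition_number_le: "7 * path_partition_number V E \<le> card V"
proof -
  have "card (set_mset P) \<le> size P"
  proof -
    have "card (set_mset P) = size (mset_set (set_mset P))"
      by simp
    also have "\<dots> \<le> size P"
      by (intro size_mset_mono subset_sub[OF pp]) auto
    finally show ?thesis .
  qed
  moreover have "path_partition_number V E \<le> card (set_mset P)"
    unfolding path_partition_number_def using path_partition_of by (intro Least_le exI[of _ "set_mset P"]) auto
  ultimately show ?thesis
    using size_bound by linarith
qed

end

theorem theorem1:
  fixes V :: "'a set" and E :: "'a \<Rightarrow> 'a \<Rightarrow> bool"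
  assumes "simple_graph V E" and "regular V E 6"
  shows "real (path_partition_number V E) \<le> real (card V) / 7"
proof -
  interpret six_regular V E
    using assms by unfold_locales
  obtain P where "opt P"
    using ex_opt by blast
  then interpret optimal V E P
    by unfold_locales
  show ?thesis
    using path_partition_number_le by linarith
qed

end
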